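(* Let $d$ be an integer with $d\ge 6$ or $d\in\{3,4\}$. Then the $d$-dimensional unit ball $B_d\subset\mathbb{R}^d$ (either open or closed) can be decomposed into finitely many congruent pieces; that is, there is an integer $m\ge 2$ such that $B_d$ is $m$-divisible.
   Context: For a cardinal number $m$, a set $K\subset\mathbb{R}^d$ is called $m$-divisible if $K$ can be decomposed into $m$ pairwise disjoint pieces which are congruent to each other, i.e. any two pieces are mapped onto each other by an isometry of $\mathbb{R}^d$ (an element of the full isometry group of $d$-dimensional Euclidean space). *)

theory Defs
  imports "HOL-Analysis.Analysis"
begin

definition euclidean_isometry :: "('a::euclidean_space \<Rightarrow> 'a) \<Rightarrow> bool" where
  "euclidean_isometry f \<longleftrightarrow> bij f \<and> (\<forall>x y. dist (f x) (f y) = dist x y)"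

definition congruent_sets :: "'a::euclidean_space set \<Rightarrow> 'a set \<Rightarrow> bool" where
  "congruent_sets A B \<longleftrightarrow> (\<exists>f. euclidean_isometry f \<and> f ` A = B)"

text \<open>A cardinal number \<open>m\<close> is represented by an index set \<open>I\<close> of cardinality \<open>m\<close>; a finite \<open>m\<close>
  by \<open>{..<m}\<close>.\<close>

definition divisible_by_index :: "'i set \<Rightarrow> 'a::euclidean_space set \<Rightarrow> bool" where
  "divisible_by_index I K \<longleftrightarrow>
    (\<exists>P. disjoint_family_on P I \<and> (\<Union>i\<in>I. P i) = K \<and>
         (\<forall>i\<in>I. \<forall>j\<in>I. congruent_sets (P i) (P j)))"

abbreviation m_divisible :: "nat \<Rightarrow> 'a::euclidean_space set \<Rightarrow> bool" where
  "m_divisible m K \<equiv> divisible_by_index {..<m} K"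

end

theory Submission
  imports Defs
begin

text \<open>
  The pieces are the images of one set \<open>A\<close> under finitely many linear isometries \<open>\<rho>\<^sub>i\<close> and one
  translation \<open>x \<mapsto> x + u\<close> with a small vector \<open>u\<close>. Linear isometries alone cannot do it, because all
  pieces would treat the centre alike; with the translation the centre is covered exactly once, as
  the translate of \<open>- u\<close>.

  \<^bold>\<open>Matching.\<close> The set \<open>A\<close> must be such that all images of its points lie in the ball and such that
  every point of the ball is the image of exactly one point of \<open>A\<close> under exactly one of the maps.
  For each \<open>x\<close> fix one of the maps, the label of \<open>x\<close>, and let \<open>y x\<close> be the preimage of \<open>x\<close> under it;
  the other images of \<open>y x\<close> are the children of \<open>x\<close>. If no point is a child twice, and if some level
  drops strictly from parent to child, then the points form a forest, and one can decide alternately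
  along its branches: \<open>x\<close> contributes \<open>y x\<close> to \<open>A\<close> exactly if it is not already covered as the child
  of a contributing parent (\<open>forest_kernel\<close>, \<open>divisible_if_children_unique\<close>).

  \<^bold>\<open>Level.\<close> The level is a \<open>p\<close>-adic valuation. The \<open>\<rho>\<^sub>i\<close> have rational entries with denominator
  divisible by \<open>p\<close>, and modulo \<open>p\<close> they behave like the letters of a free group: if \<open>\<rho>\<^sub>i\<close> or its
  inverse lowers the valuation of a vector by the full exponent of \<open>p\<close> in its denominator, then so
  does any letter applied next, except the inverse of the one just used. Thus, if the label of \<open>x\<close>
  is a letter whose inverse lowers the valuation of \<open>x\<close>, all linear children have a still lower
  valuation, and the letter leading to a child can be read off from the child. The translation
  does not disturb this unless the valuations of the vector and of \<open>u\<close> coincide; the exponents are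
  distinct for distinct letters, so this coincidence spoils at most one label. Vectors with
  irrational coordinates are mapped to nonzero rational ones by a functional on the
  \<open>\<rat>\<close>-vector space \<open>\<real>\<close> that vanishes on \<open>\<rat>\<close>; in this image the translation is invisible
  (\<open>rational_state_map\<close>). The theorem of the locale \<open>expanding_isometries\<close> puts this together.

  \<^bold>\<open>Staying in the ball.\<close> If \<open>x\<close> has label \<open>i\<close>, then \<open>inv \<rho>\<^sub>i x + u\<close> has to lie in the ball, which holds
  if \<open>\<rho>\<^sub>i u\<close> points away from \<open>x\<close>. Congruence conditions modulo powers of \<open>p\<close> leave the real
  positions of the \<open>\<rho>\<^sub>i\<close> free up to any given accuracy, so the directions of the \<open>\<rho>\<^sub>i u\<close> can be spread
  so that every \<open>x\<close> has four possible labels. At most two of them fail to lower the valuation, at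
  most one meets the valuation of \<open>u\<close>, and one remains.

  \<^bold>\<open>Dimension.\<close> The letters come from quaternions: \<open>x \<mapsto> b x b\<^sup>* / |b|\<^sup>2\<close> on the three-dimensional space of
  imaginary quaternions and \<open>x \<mapsto> b\<^sup>2 x / |b|\<^sup>2\<close> on the four-dimensional space of all quaternions. Modulo
  a prime dividing \<open>|b|\<^sup>2\<close>, a quaternion \<open>b\<close> is a \<open>2 \<times> 2\<close> matrix of rank one, and the free behaviour of
  the letters says that the lines involved are distinct. Blocks of dimensions three and four add
  up to every dimension \<open>3 a + 4 b\<close>, that is, to \<open>3\<close>, \<open>4\<close> and all dimensions from \<open>6\<close> on.
\<close>

section \<open>Matching in a forest of choices\<close>

lemma relpow_unique_source:
  fixes R :: "('a \<times> 'a) set"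
  assumes "single_valued (R\<inverse>)" "(a, x) \<in> R ^^ k" "(b, x) \<in> R ^^ k"
  shows "a = b"
  using assms(2,3)
proof (induction k arbitrary: x)
  case (Suc k)
  then obtain y z where "(a, y) \<in> R ^^ k" "(y, x) \<in> R" "(b, z) \<in> R ^^ k" "(z, x) \<in> R" by auto
  moreover from this have "y = z" using assms(1) by (auto simp: single_valued_def)
  ultimately show ?case using Suc.IH by blast
qed simp

lemma relpow_split_source:
  assumes "single_valued (R\<inverse>)" "(a, x) \<in> R ^^ k" "(b, x) \<in> R ^^ (k + l)"
  shows "(b, a) \<in> R ^^ l"
proof -
  from assms(3) have "(b, x) \<in> R ^^ (l + k)" by (simp add: add.commute)
  then obtain c where c: "(b, c) \<in> R ^^ l" "(c, x) \<in> R ^^ k"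
    by (auto simp: relpow_add)
  with relpow_unique_source[OF assms(1,2)] show ?thesis by blast
qed

lemma relpow_level:
  fixes lev :: "'a \<Rightarrow> 'b::order"
  assumes "\<And>a x. (a, x) \<in> R \<Longrightarrow> lev x < lev a" "(a, x) \<in> R ^^ k"
  shows "lev x \<le> lev a" "k > 0 \<Longrightarrow> lev x < lev a"
proof -
  have "lev x \<le> lev a \<and> (k > 0 \<longrightarrow> lev x < lev a)"
    using assms(2)
  proof (induction k arbitrary: x)
    case (Suc k)
    then obtain y where "(a, y) \<in> R ^^ k" "(y, x) \<in> R" by auto
    with Suc.IH[of y] assms(1)[of y x] show ?case by auto
  qed simp
  then show "lev x \<le> lev a" "k > 0 \<Longrightarrow> lev x < lev a" by auto
qed

lemma relpow_unique_length:
  fixes lev :: "'a \<Rightarrow> 'b::order"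
  assumes sv: "single_valued (R\<inverse>)" and lev: "\<And>a x. (a, x) \<in> R \<Longrightarrow> lev x < lev a"
    and k: "(a, x) \<in> R ^^ k" and l: "(a, x) \<in> R ^^ l"
  shows "k = l"
proof -
  have *: "i \<ge> j" if i: "(a, x) \<in> R ^^ i" and j: "(a, x) \<in> R ^^ j" for i j
  proof (rule ccontr)
    assume "\<not> i \<ge> j"
    then obtain m where m: "j = i + m" "m > 0" by (metis less_imp_add_positive not_le)
    from relpow_split_source[OF sv i, of a m] j m have "(a, a) \<in> R ^^ m" by simp
    from relpow_level(2)[OF lev this m(2)] show False by simp
  qed
  show ?thesis using *[OF k l] *[OF l k] by simp
qed

text \<open>Unique sources and a strict level make the undirected graph of \<open>R\<close> a forest, in which distances have
a well-defined parity. Colour each component by the parity of the distance to a representative. The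
representative is a root whenever there is one, so that roots, having no source, get the colour
\<open>True\<close>. No well-foundedness is assumed: a component may extend infinitely far up.\<close>

lemma forest_kernel:
  fixes R :: "('a \<times> 'a) set" and lev :: "'a \<Rightarrow> 'b::order"
  assumes sv: "single_valued (R\<inverse>)" and lev: "\<And>a x. (a, x) \<in> R \<Longrightarrow> lev x < lev a"
  shows "\<exists>C. \<forall>x. C x \<longleftrightarrow> \<not> (\<exists>a. (a, x) \<in> R \<and> C a)"
proof -
  define root where "root r \<longleftrightarrow> (\<forall>a. (a, r) \<notin> R)" for r
  define K where "K x = {r. \<exists>a k l. (a, x) \<in> R ^^ k \<and> (a, r) \<in> R ^^ l}" for x
  define rep where "rep S = (SOME r. r \<in> S \<and> ((\<exists>s\<in>S. root s) \<longrightarrow> root r))" for S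
  define C where "C x \<longleftrightarrow> (\<exists>a k l. (a, x) \<in> R ^^ k \<and> (a, rep (K x)) \<in> R ^^ l \<and> even (k + l))" for x
  have refl: "x \<in> K x" for x
  proof -
    have "(x, x) \<in> R ^^ 0" by simp
    then show ?thesis unfolding K_def by blast
  qed
  have rep: "rep (K x) \<in> K x \<and> ((\<exists>s\<in>K x. root s) \<longrightarrow> root (rep (K x)))" for x
    unfolding rep_def by (rule someI_ex) (use refl[of x] in blast)
  have K_step: "K x = K b" if "(b, x) \<in> R" for x b
  proof (intro equalityI subsetI)
    fix r assume "r \<in> K b"
    then obtain a k l where "(a, b) \<in> R ^^ k" "(a, r) \<in> R ^^ l" unfolding K_def by auto
    moreover from this have "(a, x) \<in> R ^^ Suc k" using that by auto
    ultimately show "r \<in> K x" unfolding K_def by blast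
  next
    fix r assume "r \<in> K x"
    then obtain a k l where a: "(a, x) \<in> R ^^ k" "(a, r) \<in> R ^^ l" unfolding K_def by auto
    show "r \<in> K b"
    proof (cases k)
      case 0
      with a that have "(b, r) \<in> R ^^ Suc l" using relpow_Suc_I2[of b x R r l] by simp
      moreover have "(b, b) \<in> R ^^ 0" by simp
      ultimately show ?thesis unfolding K_def by blast
    next
      case (Suc j)
      with relpow_split_source[OF sv, of b x 1 a j] a that have "(a, b) \<in> R ^^ j" by auto
      with a show ?thesis unfolding K_def by blast
    qed
  qed
  have parity: "even (k + l) \<longleftrightarrow> even (k' + l')"
    if "(a, x) \<in> R ^^ k" "(a, r) \<in> R ^^ l" "(b, x) \<in> R ^^ k'" "(b, r) \<in> R ^^ l'"
    for a b x r k l k' l'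
  proof -
    have *: "even (k + l) \<longleftrightarrow> even (k' + l')"
      if h: "(a, x) \<in> R ^^ k" "(a, r) \<in> R ^^ l" "(b, x) \<in> R ^^ k'" "(b, r) \<in> R ^^ l'" "k \<le> k'"
      for a b k l k' l'
    proof -
      from h(5) obtain m where m: "k' = k + m" using le_Suc_ex by blast
      have "(b, a) \<in> R ^^ m" using relpow_split_source[OF sv h(1)] h(3) m by simp
      with h(2) have "(b, r) \<in> R ^^ (m + l)" by (auto simp: relpow_add)
      then have "m + l = l'" using relpow_unique_length[OF sv, of lev] lev h(4) by blast
      with m show ?thesis by auto
    qed
    show ?thesis using *[OF that] *[OF that(3,4,1,2)] by (cases "k \<le> k'") auto
  qed
  have C_iff: "C x \<longleftrightarrow> even (k + l)"
    if "(a, x) \<in> R ^^ k" "(a, rep (K x)) \<in> R ^^ l" for a x k l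
    unfolding C_def using parity[OF that] that by blast
  have "C x \<longleftrightarrow> \<not> (\<exists>a. (a, x) \<in> R \<and> C a)" for x
  proof (cases "root x")
    case True
    from rep[of x] obtain a k l where a: "(a, x) \<in> R ^^ k" "(a, rep (K x)) \<in> R ^^ l"
      unfolding K_def by auto
    have no: "(d, y) \<in> R ^^ j \<Longrightarrow> root y \<Longrightarrow> j = 0 \<and> d = y" for d y j
      unfolding root_def by (cases j) auto
    have "root (rep (K x))" using rep[of x] refl[of x] True by blast
    with no a True have "k = 0" "l = 0" by blast+
    with C_iff[OF a] have "C x" by simp
    then show ?thesis using True unfolding root_def by blast
  next
    case False
    then obtain b where b: "(b, x) \<in> R" unfolding root_def by blast
    then have only: "(a, x) \<in> R \<longleftrightarrow> a = b" for a using sv by (auto simp: single_valued_def)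
    from rep[of b] obtain a k l where a: "(a, b) \<in> R ^^ k" "(a, rep (K b)) \<in> R ^^ l"
      unfolding K_def by auto
    have "(a, x) \<in> R ^^ Suc k" using a(1) b by auto
    with C_iff[OF this, of l] C_iff[OF a] a(2) K_step[OF b] have "C x \<longleftrightarrow> \<not> C b" by simp
    then show ?thesis using only by simp
  qed
  then show ?thesis by blast
qed

lemma euclidean_isometry_transport:
  assumes "euclidean_isometry f" "euclidean_isometry g"
  shows "congruent_sets (f ` A) (g ` A)"
proof -
  have f: "bij f" "\<And>x y. dist (f x) (f y) = dist x y"
    and g: "bij g" "\<And>x y. dist (g x) (g y) = dist x y"
    using assms unfolding euclidean_isometry_def by auto
  have "bij (g \<circ> inv f)" using f(1) g(1) by (simp add: bij_comp bij_imp_bij_inv)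
  moreover have "dist (inv f x) (inv f y) = dist x y" for x y
    using f(2)[of "inv f x" "inv f y"] f(1) by (simp add: bij_def surj_f_inv_f)
  ultimately have "euclidean_isometry (g \<circ> inv f)"
    unfolding euclidean_isometry_def by (simp add: g(2))
  moreover have "(g \<circ> inv f) ` (f ` A) = g ` A"
    using f(1) by (simp add: image_comp bij_def)
  ultimately show ?thesis unfolding congruent_sets_def by blast
qed

text \<open>The label \<open>l x\<close> names the map that covers \<open>x\<close> when \<open>x\<close> is to be covered by its own choice, and \<open>y x\<close>
is the point that this puts into the common preimage of the pieces. Choosing \<open>y x\<close> also covers the
other images of \<open>y x\<close>, so a point makes its choice exactly if the point of which it is a child does
not. Every point is then covered once: by its own choice or by that of its parent.\<close>

lemma divisible_if_children_unique:
  fixes B :: "'a::euclidean_space set" and f :: "nat \<Rightarrow> 'a \<Rightarrow> 'a" and lev :: "'a \<Rightarrow> 'b::order"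
  assumes iso: "\<And>i. i < m \<Longrightarrow> euclidean_isometry (f i)"
    and label: "\<And>x. x \<in> B \<Longrightarrow> l x < m \<and> f (l x) (y x) = x"
    and stays: "\<And>x i. x \<in> B \<Longrightarrow> i < m \<Longrightarrow> f i (y x) \<in> B"
    and level: "\<And>x i. x \<in> B \<Longrightarrow> i < m \<Longrightarrow> i \<noteq> l x \<Longrightarrow> lev (f i (y x)) < lev x"
    and unique: "\<And>a b i j. \<lbrakk>a \<in> B; b \<in> B; i < m; j < m; i \<noteq> l a; j \<noteq> l b; f i (y a) = f j (y b)\<rbrakk> \<Longrightarrow> i = j"
  shows "m_divisible m B"
proof -
  define R where "R = {(a, x). a \<in> B \<and> (\<exists>i<m. i \<noteq> l a \<and> x = f i (y a))}"
  \<comment> \<open>Injectivity gives equal preimages; two parents with the same preimage but different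
    labels would be children of each other, against the level.\<close>
  have "single_valued (R\<inverse>)"
    unfolding single_valued_def
  proof (intro allI impI)
    fix x a b assume "(x, a) \<in> R\<inverse>" "(x, b) \<in> R\<inverse>"
    then obtain i j where i: "a \<in> B" "i < m" "i \<noteq> l a" "x = f i (y a)"
      and j: "b \<in> B" "j < m" "j \<noteq> l b" "x = f j (y b)"
      unfolding R_def by auto
    have "i = j" using unique[of a b i j] i j by simp
    then have y: "y a = y b"
      using i j iso[of i] unfolding euclidean_isometry_def bij_def inj_def by metis
    show "a = b"
    proof (rule ccontr)
      assume "a \<noteq> b"
      then have "l a \<noteq> l b" using label i(1) j(1) y by metis
      then have "lev a < lev b" "lev b < lev a"
        using level[OF j(1), of "l a"] level[OF i(1), of "l b"] label i(1) j(1) y by metis+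
      then show False by simp
    qed
  qed
  moreover have "lev x < lev a" if "(a, x) \<in> R" for a x
    using that level unfolding R_def by auto
  ultimately obtain C where C: "\<And>x. C x \<longleftrightarrow> \<not> (\<exists>a. (a, x) \<in> R \<and> C a)"
    using forest_kernel[of R lev] by blast
  define A where "A = {y x | x. x \<in> B \<and> C x}"
  have "disjoint_family_on (\<lambda>i. f i ` A) {..<m}"
  proof (clarsimp simp: disjoint_family_on_def)
    fix i j assume ij: "i < m" "j < m" "i \<noteq> j"
    have False if "x \<in> f i ` A" "x \<in> f j ` A" for x
    proof -
      from that obtain a b where a: "a \<in> B" "C a" "x = f i (y a)" and b: "b \<in> B" "C b" "x = f j (y b)"
        unfolding A_def by auto
      show False
      proof (cases "i = l a")
        case True
        then have xa: "x = a" using label a by simp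
        show False
        proof (cases "j = l b")
          case True
          then have "x = b" using label b by simp
          with xa True \<open>i = l a\<close> ij show False by simp
        next
          case False
          then have "(b, a) \<in> R" unfolding R_def using b ij xa by auto
          with C[of a] a(2) b(2) show False by blast
        qed
      next
        case False
        show False
        proof (cases "j = l b")
          case True
          then have "x = b" using label b by simp
          with False have "(a, b) \<in> R" unfolding R_def using a ij by auto
          with C[of b] a(2) b(2) show False by blast
        next
          case F: False
          with False unique[of a b i j] a b ij show False by simp
        qed
      qed
    qed
    then show "f i ` A \<inter> f j ` A = {}" by blast
  qed
  moreover have "(\<Union>i\<in>{..<m}. f i ` A) = B"
  proof (intro equalityI subsetI)
    fix x assume "x \<in> (\<Union>i\<in>{..<m}. f i ` A)"
    then show "x \<in> B" using stays unfolding A_def by auto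
  next
    fix x assume x: "x \<in> B"
    show "x \<in> (\<Union>i\<in>{..<m}. f i ` A)"
    proof (cases "C x")
      case True
      with x have "y x \<in> A" unfolding A_def by blast
      with label[OF x] show ?thesis by (metis UN_iff imageI lessThan_iff)
    next
      case False
      with C obtain a where "(a, x) \<in> R" "C a" by blast
      then show ?thesis unfolding R_def A_def by auto
    qed
  qed
  moreover have "\<forall>i\<in>{..<m}. \<forall>j\<in>{..<m}. congruent_sets (f i ` A) (f j ` A)"
    by (intro ballI euclidean_isometry_transport iso) auto
  ultimately show ?thesis unfolding divisible_by_index_def by (intro exI[of _ "\<lambda>i. f i ` A"]) blast
qed

section \<open>Rational coordinates of real vectors\<close>

definition rational_vec :: "real ^ 'n \<Rightarrow> bool" where
  "rational_vec x \<longleftrightarrow> (\<forall>k. x $ k \<in> \<rat>)"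

definition rational_map :: "(real ^ 'n \<Rightarrow> real ^ 'n) \<Rightarrow> bool" where
  "rational_map f \<longleftrightarrow> linear f \<and> (\<forall>l. rational_vec (f (axis l 1)))"

lemma linear_apply_axis:
  fixes f :: "real ^ 'n::finite \<Rightarrow> real ^ 'n"
  assumes "linear f"
  shows "f x $ k = (\<Sum>l\<in>UNIV. x $ l * f (axis l 1) $ k)"
proof -
  have "f x = f (\<Sum>l\<in>UNIV. x $ l *\<^sub>R axis l 1)"
    by (simp add: basis_expansion flip: scalar_mult_eq_scaleR)
  also have "\<dots> = (\<Sum>l\<in>UNIV. x $ l *\<^sub>R f (axis l 1))"
    by (simp add: linear_sum[OF assms] linear_cmul[OF assms])
  finally show ?thesis by simp
qed


text \<open>The coordinate functionals with respect to a basis of the reals over the rationals that contains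
\<open>1\<close>.\<close>

lemma rational_hamel_functionals:
  obtains \<phi> :: "real \<Rightarrow> real \<Rightarrow> real"
  where "\<And>b r. \<phi> b r \<in> \<rat>"
    and "\<And>b r s. \<phi> b (r + s) = \<phi> b r + \<phi> b s"
    and "\<And>b q r. q \<in> \<rat> \<Longrightarrow> \<phi> b (q * r) = q * \<phi> b r"
    and "\<And>b q. b \<noteq> 1 \<Longrightarrow> q \<in> \<rat> \<Longrightarrow> \<phi> b q = 0"
    and "\<And>r. (\<And>b. b \<noteq> 1 \<Longrightarrow> \<phi> b r = 0) \<Longrightarrow> r \<in> \<rat>"
proof -
  interpret Q: vector_space "\<lambda>(q::rat) (r::real). of_rat q * r"
    by unfold_locales (auto simp: algebra_simps of_rat_add of_rat_mult)
  define B where "B = Q.extend_basis {1::real}"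
  have ind1: "\<not> Q.dependent {1::real}" by simp
  have B: "\<not> Q.dependent B" "Q.span B = UNIV" "1 \<in> B"
    using Q.independent_extend_basis[OF ind1] Q.span_extend_basis[OF ind1]
      Q.extend_basis_superset[OF ind1] unfolding B_def by auto
  define \<phi> where "\<phi> b r = (of_rat (Q.representation B r b) :: real)" for b r
  have scale: "\<phi> b (q * r) = q * \<phi> b r" if "q \<in> \<rat>" for b q r
    using that Q.representation_scale[OF B(1), of r] unfolding \<phi>_def Rats_def
    by (auto simp: B(2) of_rat_mult)
  have one: "\<phi> b 1 = 0" if "b \<noteq> 1" for b
    using Q.representation_basis[OF B(1,3)] that by (simp add: \<phi>_def)
  show ?thesis
  proof (rule that[of \<phi>])
    show "\<phi> b r \<in> \<rat>" for b r by (simp add: \<phi>_def)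
    show "\<phi> b (r + s) = \<phi> b r + \<phi> b s" for b r s
      using Q.representation_add[OF B(1), of s r] by (simp add: \<phi>_def B(2) of_rat_add)
    show "\<phi> b (q * r) = q * \<phi> b r" if "q \<in> \<rat>" for b q r by (rule scale[OF that])
    show "\<phi> b q = 0" if "b \<noteq> 1" "q \<in> \<rat>" for b q
      using scale[OF that(2), of b 1] one[OF that(1)] by simp
    show "r \<in> \<rat>" if *: "\<And>b. b \<noteq> 1 \<Longrightarrow> \<phi> b r = 0" for r
    proof -
      have sub: "{b. Q.representation B r b \<noteq> 0} \<subseteq> {1}"
        using * by (auto simp: \<phi>_def)
      have "r = (\<Sum>b | Q.representation B r b \<noteq> 0. of_rat (Q.representation B r b) * b)"
        using Q.sum_nonzero_representation_eq[OF B(1), of r] B(2) by simp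
      also have "\<dots> \<in> \<rat>"
        by (rule Rats_sum) (use sub in auto)
      finally show ?thesis .
    qed
  qed
qed

text \<open>A point with irrational coordinates is followed through one Hamel coordinate, chosen from the set of
coordinates other than that of \<open>1\<close> in which the point does not vanish. Invertible rational maps and
rational translations do not change this set, hence the same coordinate is used along the whole
orbit. Valuations need rational vectors, and this map provides one for every point, vanishing only
at the origin.\<close>

lemma rational_state_map:
  obtains \<zeta> :: "real ^ 'n::finite \<Rightarrow> real ^ 'n"
  where "\<And>x. rational_vec (\<zeta> x)" and "\<And>x. \<zeta> x = 0 \<longleftrightarrow> x = 0"
    and "\<And>x. rational_vec x \<Longrightarrow> \<zeta> x = x"
    and "\<And>f g x. \<lbrakk>rational_map f; rational_map g; \<And>y. g (f y) = y\<rbrakk> \<Longrightarrow> \<zeta> (f x) = f (\<zeta> x)"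
    and "\<And>x u. \<lbrakk>rational_vec u; \<not> rational_vec x\<rbrakk> \<Longrightarrow> \<zeta> (x + u) = \<zeta> x"
proof -
  obtain \<phi> :: "real \<Rightarrow> real \<Rightarrow> real" where \<phi>: "\<And>b r. \<phi> b r \<in> \<rat>"
    "\<And>b r s. \<phi> b (r + s) = \<phi> b r + \<phi> b s"
    "\<And>b q r. q \<in> \<rat> \<Longrightarrow> \<phi> b (q * r) = q * \<phi> b r"
    "\<And>b q. b \<noteq> 1 \<Longrightarrow> q \<in> \<rat> \<Longrightarrow> \<phi> b q = 0"
    "\<And>r. (\<And>b. b \<noteq> 1 \<Longrightarrow> \<phi> b r = 0) \<Longrightarrow> r \<in> \<rat>"
    using rational_hamel_functionals by blast
  define \<Phi> where "\<Phi> b x = (\<chi> k. \<phi> b (x $ k))" for b and x :: "real ^ 'n"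
  define S where "S x = {b. b \<noteq> 1 \<and> \<Phi> b x \<noteq> 0}" for x
  define \<zeta> where "\<zeta> x = (if S x = {} then x else \<Phi> (SOME b. b \<in> S x) x)" for x
  have S_empty: "S x = {} \<longleftrightarrow> rational_vec x" for x
    using \<phi>(4,5) unfolding S_def rational_vec_def \<Phi>_def by (auto simp: vec_eq_iff) blast
  have in_S: "(SOME b. b \<in> S x) \<in> S x" if "S x \<noteq> {}" for x
    using that by (simp add: some_in_eq)
  have \<Phi>_rat: "rational_vec (\<Phi> b x)" for b x
    using \<phi>(1) by (simp add: rational_vec_def \<Phi>_def)
  have zero: "\<phi> b 0 = 0" for b using \<phi>(3)[of 0 b 0] by simp
  have sum: "\<phi> b (sum h A) = (\<Sum>i\<in>A. \<phi> b (h i))" if "finite A" for b A and h :: "'n \<Rightarrow> real"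
    using that by (induction A) (auto simp: zero \<phi>(2))
  have \<Phi>_map: "\<Phi> b (f x) = f (\<Phi> b x)" if "rational_map f" for b x f
  proof -
    have lin: "linear f" and q: "f (axis l 1) $ k \<in> \<rat>" for l k
      using that unfolding rational_map_def rational_vec_def by auto
    have "\<phi> b (x $ l * f (axis l 1) $ k) = \<phi> b (x $ l) * f (axis l 1) $ k" for l k
      using \<phi>(3)[OF q, of b l k "x $ l"] by (simp only: mult.commute)
    then show ?thesis
      by (simp add: vec_eq_iff \<Phi>_def linear_apply_axis[OF lin, of x]
          linear_apply_axis[OF lin, of "vec_lambda _"] sum)
  qed
  have S_map: "S (f x) = S x"
    if f: "rational_map f" and g: "rational_map g" and gf: "\<And>y. g (f y) = y" for f g x
  proof -
    have lin: "f 0 = 0" "g 0 = 0" using f g linear_0 unfolding rational_map_def by auto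
    have "\<Phi> b (f x) = 0 \<longleftrightarrow> \<Phi> b x = 0" for b
      using \<Phi>_map[OF f] gf lin by metis
    then show ?thesis by (simp add: S_def)
  qed
  show ?thesis
  proof (rule that[of \<zeta>])
    show "rational_vec (\<zeta> x)" for x
      using S_empty \<Phi>_rat by (simp add: \<zeta>_def)
    show "\<zeta> x = 0 \<longleftrightarrow> x = 0" for x
    proof (cases "S x = {}")
      case False
      then have "\<zeta> x \<noteq> 0" using in_S[OF False] by (auto simp: \<zeta>_def S_def)
      moreover have "x \<noteq> 0" using False S_empty[of x] by (auto simp: rational_vec_def)
      ultimately show ?thesis by simp
    qed (simp add: \<zeta>_def)
    show "\<zeta> x = x" if "rational_vec x" for x using that S_empty by (simp add: \<zeta>_def)
    show "\<zeta> (f x) = f (\<zeta> x)"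
      if "rational_map f" "rational_map g" "\<And>y. g (f y) = y" for f g x
      using S_map[OF that] \<Phi>_map[OF that(1)] by (simp add: \<zeta>_def)
    show "\<zeta> (x + u) = \<zeta> x" if "rational_vec u" "\<not> rational_vec x" for x u
    proof -
      have *: "\<Phi> b (x + u) = \<Phi> b x" if "b \<noteq> 1" for b
        using that \<open>rational_vec u\<close> by (simp add: \<Phi>_def vec_eq_iff \<phi>(2,4) rational_vec_def)
      then have S: "S (x + u) = S x" by (auto simp: S_def)
      have ne: "S x \<noteq> {}" using that S_empty by blast
      then have "(SOME b. b \<in> S x) \<noteq> 1" using in_S[of x] by (simp add: S_def)
      then show ?thesis unfolding \<zeta>_def S using * ne by simp
    qed
  qed
qed

section \<open>The valuation at a prime\<close>

text \<open>Calculations modulo \<open>p\<close> take place in the ring of rationals without \<open>p\<close> in the denominator, embedded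
in the reals; its prime ideal is described by \<open>divisible_at\<close>.\<close>

locale prime_place =
  fixes p :: nat
  assumes prime: "prime p"
begin

definition integral_at :: "real \<Rightarrow> bool" where
  "integral_at r \<longleftrightarrow> (\<exists>a b :: int. \<not> int p dvd b \<and> r = of_int a / of_int b)"

definition divisible_at :: "real \<Rightarrow> bool" where
  "divisible_at r \<longleftrightarrow> integral_at (r / p)"

lemma p_pos: "real p > 0"
  using prime prime_gt_0_nat by simp

lemma prime_int: "prime (int p)"
  using prime by simp

lemma integral_of_int [simp]: "integral_at (of_int k)"
  unfolding integral_at_def using prime_int
  by (intro exI[of _ k] exI[of _ 1]) (auto simp: not_prime_unit)

lemma integral_simple [simp]: "integral_at 0" "integral_at 1" "integral_at (numeral w)" "integral_at (of_nat k)"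
  using integral_of_int[of 0] integral_of_int[of 1] integral_of_int[of "numeral w"]
    integral_of_int[of "int k"] by auto

lemma integral_mult: "integral_at r \<Longrightarrow> integral_at s \<Longrightarrow> integral_at (r * s)"
  unfolding integral_at_def
proof (elim exE conjE)
  fix a b c d :: int assume "\<not> int p dvd b" "r = of_int a / of_int b" "\<not> int p dvd d" "s = of_int c / of_int d"
  then show "\<exists>a b :: int. \<not> int p dvd b \<and> r * s = of_int a / of_int b"
    using prime_int by (intro exI[of _ "a * c"] exI[of _ "b * d"]) (auto simp: prime_dvd_mult_iff)
qed

lemma integral_add: "integral_at r \<Longrightarrow> integral_at s \<Longrightarrow> integral_at (r + s)"
  unfolding integral_at_def
proof (elim exE conjE)
  fix a b c d :: int
  assume *: "\<not> int p dvd b" "r = of_int a / of_int b" "\<not> int p dvd d" "s = of_int c / of_int d"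
  then have "b \<noteq> 0" "d \<noteq> 0" by auto
  then show "\<exists>a b :: int. \<not> int p dvd b \<and> r + s = of_int a / of_int b"
    using prime_int * by (intro exI[of _ "a * d + c * b"] exI[of _ "b * d"])
      (auto simp: prime_dvd_mult_iff field_simps)
qed

lemma integral_minus: "integral_at r \<Longrightarrow> integral_at (- r)"
  using integral_mult[of "of_int (- 1)" r] integral_of_int[of "- 1"] by simp

lemma integral_diff: "integral_at r \<Longrightarrow> integral_at s \<Longrightarrow> integral_at (r - s)"
  using integral_add[of r "- s"] integral_minus[of s] by simp

lemma integral_power: "integral_at r \<Longrightarrow> integral_at (r ^ k)"
  by (induction k) (auto intro: integral_mult)

lemma integral_sum: "(\<And>i. i \<in> A \<Longrightarrow> integral_at (f i)) \<Longrightarrow> integral_at (sum f A)"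
  by (induction A rule: infinite_finite_induct) (auto intro: integral_add)

lemmas integral_intros = integral_mult integral_add integral_minus integral_diff integral_power

lemma divisible_mult: "divisible_at r \<Longrightarrow> integral_at s \<Longrightarrow> divisible_at (r * s)"
  "divisible_at r \<Longrightarrow> integral_at s \<Longrightarrow> divisible_at (s * r)"
  unfolding divisible_at_def using integral_mult[of "r / p" s] by (auto simp: mult.commute)

lemma divisible_add: "divisible_at r \<Longrightarrow> divisible_at s \<Longrightarrow> divisible_at (r + s)"
  unfolding divisible_at_def using integral_add[of "r / p" "s / p"] by (simp add: add_divide_distrib)

lemma divisible_minus: "divisible_at r \<Longrightarrow> divisible_at (- r)"
  unfolding divisible_at_def using integral_minus[of "r / p"] by simp

lemma divisible_diff: "divisible_at r \<Longrightarrow> divisible_at s \<Longrightarrow> divisible_at (r - s)"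
  using divisible_add[of r "- s"] divisible_minus[of s] by simp

lemma divisible_0 [simp]: "divisible_at 0"
  by (simp add: divisible_at_def)

lemma divisible_imp_integral: "divisible_at r \<Longrightarrow> integral_at r"
  using integral_mult[of "r / p" "of_nat p"] p_pos by (simp add: divisible_at_def)

lemma divisible_of_int: "divisible_at (of_int k) \<longleftrightarrow> int p dvd k"
proof
  assume "divisible_at (of_int k)"
  then obtain a b :: int where b: "\<not> int p dvd b" and "of_int k / real p = of_int a / of_int b"
    unfolding divisible_at_def integral_at_def by auto
  moreover from b have "b \<noteq> 0" by auto
  ultimately have "of_int (k * b) = (of_int (a * int p) :: real)"
    using p_pos by (simp add: field_simps)
  then have "k * b = a * int p" by (simp only: of_int_eq_iff)
  then have "int p dvd k * b" by simp
  with b show "int p dvd k" using prime_int by (simp add: prime_dvd_mult_iff)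
next
  assume "int p dvd k"
  then obtain j where "k = int p * j" by blast
  with p_pos show "divisible_at (of_int k)" by (simp add: divisible_at_def)
qed

lemma divisible_prime:
  assumes "integral_at r" "integral_at s" "divisible_at (r * s)"
  shows "divisible_at r \<or> divisible_at s"
proof -
  from assms(1,2) obtain a b c d :: int where
    r: "\<not> int p dvd b" "r = of_int a / of_int b" and s: "\<not> int p dvd d" "s = of_int c / of_int d"
    unfolding integral_at_def by auto
  have nz: "b \<noteq> 0" "d \<noteq> 0" using r s by auto
  have "divisible_at (r * s * of_int (b * d))" 
    using divisible_mult(1)[OF assms(3) integral_of_int] by blast
  also have "r * s * of_int (b * d) = of_int (a * c)" using nz r s by simp
  finally have "int p dvd a \<or> int p dvd c"
    using prime_int by (simp only: divisible_of_int prime_dvd_mult_iff)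
  moreover have "divisible_at (of_int j * (of_int 1 / of_int h))"
    if "int p dvd j" "\<not> int p dvd h" for j h :: int
    using that by (intro divisible_mult(1)) (auto simp only: divisible_of_int integral_at_def)
  ultimately show ?thesis using r s by fastforce
qed

lemma rational_imp_scaled_integral:
  assumes "r \<in> \<rat>"
  shows "\<exists>N. integral_at (real p ^ N * r)"
proof -
  from assms obtain a b :: int where "b \<noteq> 0" "r = of_int a / of_int b"
    by (elim Rats_cases') (metis less_irrefl)
  moreover obtain c m where "b = int p ^ m * c" "\<not> int p dvd c"
    using multiplicity_decompose'[of b "int p"] \<open>b \<noteq> 0\<close> prime_int not_prime_unit by metis
  ultimately have "real p ^ m * r = of_int a / of_int c"
    using p_pos by auto
  with \<open>\<not> int p dvd c\<close> show ?thesis unfolding integral_at_def by blast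
qed

lemma integral_mono_power:
  assumes "integral_at (real p ^ N * r)" "N \<le> M"
  shows "integral_at (real p ^ M * r)"
proof -
  have "real p ^ M * r = real p ^ (M - N) * (real p ^ N * r)"
    using assms(2) by (simp add: mult.assoc[symmetric] power_add[symmetric] del: mult.assoc)
  moreover have "integral_at (real p ^ (M - N))" by (intro integral_power) simp
  ultimately show ?thesis using integral_mult assms(1) by metis
qed

lemma not_always_divisible:
  assumes "r \<noteq> 0"
  shows "\<exists>M. \<not> integral_at (r / real p ^ M)"
proof (rule ccontr)
  assume "\<not> ?thesis"
  then have all: "integral_at (r / real p ^ M)" for M by blast
  from all[of 0] obtain a b :: int where b: "\<not> int p dvd b" "r = of_int a / of_int b"
    unfolding integral_at_def by auto
  have "b \<noteq> 0" using b by auto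
  with b assms have a: "a \<noteq> 0" by auto
  have "int p ^ M dvd a" for M
  proof -
    have pM: "real p ^ M > 0" using p_pos by simp
    have "integral_at (of_int b * (r / real p ^ M))" using all by (intro integral_mult) auto
    also have "of_int b * (r / real p ^ M) = of_int a / real p ^ M" using b \<open>b \<noteq> 0\<close> by simp
    finally obtain c d :: int where d: "\<not> int p dvd d" "of_int a / real p ^ M = of_int c / of_int d"
      unfolding integral_at_def by auto
    then have "d \<noteq> 0" by auto
    with d pM have "of_int (a * d) = (of_int (int p ^ M * c) :: real)" by (simp add: field_simps)
    then have "a * d = int p ^ M * c" by (simp only: of_int_eq_iff)
    then have "int p ^ M dvd a * d" by simp
    moreover have "coprime (int p ^ M) d"
      using d(1) prime_int by (simp add: prime_imp_coprime)
    ultimately show ?thesis by (simp add: coprime_dvd_mult_left_iff)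
  qed
  moreover have "finite {M. int p ^ M dvd a}"
    using a prime_int not_prime_unit by (intro finite_divisor_powers) auto
  ultimately show False by simp
qed

definition integral_vec :: "real ^ 'n \<Rightarrow> bool" where
  "integral_vec z \<longleftrightarrow> (\<forall>k. integral_at (z $ k))"

definition divisible_vec :: "real ^ 'n \<Rightarrow> bool" where
  "divisible_vec z \<longleftrightarrow> (\<forall>k. divisible_at (z $ k))"

text \<open>The valuation of a vector is the minimum over its coordinates. As a relation, it avoids a value for
the zero vector.\<close>

definition val_ge :: "int \<Rightarrow> real ^ 'n \<Rightarrow> bool" where
  "val_ge v z \<longleftrightarrow> integral_vec ((real p powi (- v)) *\<^sub>R z)"

definition has_val :: "int \<Rightarrow> real ^ 'n \<Rightarrow> bool" where
  "has_val v z \<longleftrightarrow> val_ge v z \<and> \<not> val_ge (v + 1) z"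

lemma val_ge_add: "val_ge v y \<Longrightarrow> val_ge v z \<Longrightarrow> val_ge v (y + z)"
  unfolding val_ge_def integral_vec_def by (auto simp: distrib_left intro: integral_add)

lemma val_ge_minus: "val_ge v (- z) \<longleftrightarrow> val_ge v z"
  unfolding val_ge_def integral_vec_def using integral_minus by fastforce

lemma val_ge_mono:
  assumes "val_ge w z" "v \<le> w" shows "val_ge v z"
proof -
  from assms(2) obtain m where m: "w = v + int m" using zle_iff_zadd by auto
  have "real p powi (- v) = real p ^ m * real p powi (- w)"
    using p_pos by (simp add: m power_int_of_nat[symmetric] power_int_add[symmetric] del: power_int_of_nat)
  moreover have "integral_at (real p ^ m)" by (intro integral_power) simp
  ultimately show ?thesis using assms(1) integral_mult unfolding val_ge_def integral_vec_def
    by (simp add: mult.assoc)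
qed

lemma has_val_less: "has_val v z \<Longrightarrow> val_ge w z \<Longrightarrow> w \<le> v"
  using val_ge_mono[of w z "v + 1"] unfolding has_val_def by force

lemma has_val_unique: "has_val v z \<Longrightarrow> has_val w z \<Longrightarrow> v = w"
  using has_val_less unfolding has_val_def by (meson order_antisym)

lemma has_val_add:
  assumes "has_val v y" "val_ge (v + 1) z" shows "has_val v (y + z)"
proof -
  have "val_ge (v + 1) y" if "val_ge (v + 1) (y + z)"
    using val_ge_add[OF that, of "- z"] assms(2) by (simp add: val_ge_minus)
  then show ?thesis using assms val_ge_add[of v y z] val_ge_mono[of "v + 1" z v]
    unfolding has_val_def by auto
qed

lemma has_val_minus: "has_val v (- z) \<longleftrightarrow> has_val v z"
  by (simp add: has_val_def val_ge_minus)

lemma has_val_nonzero: "has_val v z \<Longrightarrow> z \<noteq> 0"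
  unfolding has_val_def val_ge_def integral_vec_def by auto

lemma has_val_exists:
  fixes z :: "real ^ 'n::finite"
  assumes "rational_vec z" "z \<noteq> 0" shows "\<exists>v. has_val v z"
proof -
  have "\<exists>N. \<forall>k. integral_at (real p ^ N k * z $ k)"
    using assms(1) rational_imp_scaled_integral unfolding rational_vec_def by (intro choice) blast
  then obtain N where N: "\<And>k. integral_at (real p ^ N k * z $ k)" by blast
  define M where "M = Max (range N)"
  have "integral_at (real p ^ M * z $ k)" for k
    by (rule integral_mono_power[OF N]) (simp add: M_def)
  then have low: "val_ge (- int M) z" by (simp add: val_ge_def integral_vec_def)
  from assms(2) obtain k where "z $ k \<noteq> 0" by (auto simp: vec_eq_iff)
  from not_always_divisible[OF this] obtain K where "\<not> integral_at (z $ k / real p ^ K)" by blast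
  then have "\<not> val_ge (int K) z"
    by (auto simp: val_ge_def integral_vec_def power_int_minus field_simps)
  moreover have "int K = - int M + int (K + M)" by simp
  ultimately have "\<exists>j. \<not> val_ge (- int M + int j) z" by metis
  then obtain j where j: "\<not> val_ge (- int M + int j) z" "\<And>i. i < j \<Longrightarrow> val_ge (- int M + int i) z"
    using exists_least_iff[of "\<lambda>j. \<not> val_ge (- int M + int j) z"] by blast
  with low have "j \<noteq> 0" by (intro notI) simp
  then obtain i where "j = Suc i" using not0_implies_Suc by blast
  with j have "has_val (- int M + int i) z" by (auto simp: has_val_def algebra_simps)
  then show ?thesis ..
qed

lemma val_ge_scale: "val_ge v (real p powi w *\<^sub>R z) \<longleftrightarrow> val_ge (v - w) z"
proof -
  have "real p powi - v * real p powi w = real p powi (- (v - w))"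
    using p_pos by (simp flip: power_int_add)
  then show ?thesis unfolding val_ge_def by (simp only: scaleR_scaleR)
qed

lemma has_val_scale: "has_val v (real p powi w *\<^sub>R z) \<longleftrightarrow> has_val (v - w) z"
  unfolding has_val_def val_ge_scale by (simp add: algebra_simps)

lemma val_ge_0: "val_ge 0 z \<longleftrightarrow> integral_vec z"
  by (simp add: val_ge_def)

lemma val_ge_1: "val_ge 1 z \<longleftrightarrow> divisible_vec z"
  by (simp add: val_ge_def integral_vec_def divisible_vec_def divisible_at_def power_int_minus field_simps)

end

section \<open>Expanding isometries and the decomposition\<close>

context prime_place begin

text \<open>The maps of interest have matrices in which \<open>p\<close> occurs with exponent at most \<open>k\<close> in the denominators;
a vector is expanded if its \<open>p\<close>-adic norm grows by the largest possible factor, \<open>p\<^sup>k\<close>.\<close>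

definition expands :: "nat \<Rightarrow> (real ^ 'n \<Rightarrow> real ^ 'n) \<Rightarrow> real ^ 'n \<Rightarrow> bool" where
  "expands k f z \<longleftrightarrow> (\<exists>v. has_val v z \<and> has_val (v - int k) (f z))"

lemma expandsD: "expands k f z \<Longrightarrow> has_val v z \<Longrightarrow> has_val (v - int k) (f z)"
  unfolding expands_def using has_val_unique by blast

lemma expands_not_back:
  assumes "expands k f z" "g (f z) = z" "k > 0"
  shows "\<not> expands k g (f z)"
proof
  assume "expands k g (f z)"
  from assms(1) obtain v where v: "has_val v z" "has_val (v - int k) (f z)"
    unfolding expands_def by blast
  from expandsD[OF \<open>expands k g (f z)\<close> v(2)] assms(2) v(1) have "v - int k - int k = v"
    using has_val_unique by metis
  with assms(3) show False by simp
qed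

end

text \<open>The letters are \<open>\<rho> True i\<close> and their inverses \<open>\<rho> False i\<close>. The assumption \<open>keeps_expanding\<close> is the
ping-pong condition modulo \<open>p\<close>: after an expanding letter only its own inverse can fail to expand.
The number four in \<open>room\<close> is one more than the three labels that can be unusable for \<open>p\<close>-adic
reasons, two by \<open>few_contract\<close> and one by a coincidence with the valuation of \<open>u\<close>.\<close>

locale expanding_isometries = prime_place p for p +
  fixes n :: nat and e :: "nat \<Rightarrow> nat" and \<rho> :: "bool \<Rightarrow> nat \<Rightarrow> real ^ 'n::finite \<Rightarrow> real ^ 'n"
    and u :: "real ^ 'n"
  assumes rational: "i < n \<Longrightarrow> rational_map (\<rho> s i)"
    and norm_preserving: "i < n \<Longrightarrow> norm (\<rho> s i x) = norm x"
    and inverse: "i < n \<Longrightarrow> \<rho> (\<not> s) i (\<rho> s i x) = x"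
    and e_pos: "e i > 0" and e_inj: "inj e"
    and integral: "i < n \<Longrightarrow> integral_vec z \<Longrightarrow> integral_vec (real p ^ e i *\<^sub>R \<rho> s i z)"
    and keeps_expanding: "\<lbrakk>i < n; j < n; (t, j) \<noteq> (\<not> s, i); integral_vec z;
        \<not> divisible_vec (real p ^ e i *\<^sub>R \<rho> s i z)\<rbrakk>
      \<Longrightarrow> \<not> divisible_vec (real p ^ e j *\<^sub>R \<rho> t j (real p ^ e i *\<^sub>R \<rho> s i z))"
    and few_contract: "\<lbrakk>integral_vec z; \<not> divisible_vec z\<rbrakk>
      \<Longrightarrow> card {i. i < n \<and> divisible_vec (real p ^ e i *\<^sub>R \<rho> False i z)} \<le> 2"
    and u_rational: "rational_vec u" and u_nonzero: "u \<noteq> 0" and u_small: "norm u < 1 / 2"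
    and u_expands: "i < n \<Longrightarrow> expands (e i) (\<rho> s i) u"
    and room: "1 / 2 \<le> norm x \<Longrightarrow> norm x \<le> 1 \<Longrightarrow>
      card {i. i < n \<and> norm (\<rho> False i x + u) \<le> norm x} \<ge> 4"
begin

lemma linear_\<rho>: "i < n \<Longrightarrow> linear (\<rho> s i)"
  using rational unfolding rational_map_def by blast

text \<open>Rescaling reduces statements about vectors of any valuation to integral vectors that are nonzero
modulo \<open>p\<close>, where the assumptions of the locale apply.\<close>

lemma scaled_\<rho>:
  assumes "i < n"
  shows "real p ^ e i *\<^sub>R \<rho> s i (real p powi (- v) *\<^sub>R z) = real p powi (int (e i) - v) *\<^sub>R \<rho> s i z"
proof -
  have "real p ^ e i *\<^sub>R \<rho> s i (real p powi (- v) *\<^sub>R z) = (real p powi int (e i) * real p powi (- v)) *\<^sub>R \<rho> s i z"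
    by (simp add: linear_cmul[OF linear_\<rho>[OF assms]])
  also have "real p powi int (e i) * real p powi (- v) = real p powi (int (e i) + - v)"
    using p_pos by (subst power_int_add) auto
  finally show ?thesis by simp
qed

lemma expands_iff:
  assumes "i < n" "has_val v z"
  shows "expands (e i) (\<rho> s i) z \<longleftrightarrow>
    \<not> divisible_vec (real p ^ e i *\<^sub>R \<rho> s i (real p powi (- v) *\<^sub>R z))"
proof -
  have "integral_vec (real p powi (- v) *\<^sub>R z)"
    using assms(2) by (simp add: has_val_def val_ge_def)
  from integral[OF assms(1) this, of s]
  have "val_ge 0 (real p powi (int (e i) - v) *\<^sub>R \<rho> s i z)"
    by (simp only: scaled_\<rho>[OF assms(1)] val_ge_0)
  then have "val_ge (v - int (e i)) (\<rho> s i z)" by (simp add: val_ge_scale)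
  moreover have "expands (e i) (\<rho> s i) z \<longleftrightarrow> has_val (v - int (e i)) (\<rho> s i z)"
    using assms(2) has_val_unique unfolding expands_def by blast
  moreover have "divisible_vec (real p ^ e i *\<^sub>R \<rho> s i (real p powi (- v) *\<^sub>R z)) \<longleftrightarrow>
      val_ge (v - int (e i) + 1) (\<rho> s i z)"
    by (simp only: scaled_\<rho>[OF assms(1)] val_ge_scale val_ge_1[symmetric]) (simp add: algebra_simps)
  ultimately show ?thesis by (simp add: has_val_def)
qed

lemma expands_step:
  assumes "i < n" "j < n" "(t, j) \<noteq> (\<not> s, i)" "expands (e i) (\<rho> s i) z"
  shows "expands (e j) (\<rho> t j) (\<rho> s i z)"
proof -
  obtain v where v: "has_val v z" "has_val (v - int (e i)) (\<rho> s i z)"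
    using assms(4) unfolding expands_def by blast
  have "integral_vec (real p powi (- v) *\<^sub>R z)" using v(1) by (simp add: has_val_def val_ge_def)
  from keeps_expanding[OF assms(1-3) this] expands_iff[OF assms(1) v(1), of s] assms(4)
  have "\<not> divisible_vec (real p ^ e j *\<^sub>R \<rho> t j (real p powi (int (e i) - v) *\<^sub>R \<rho> s i z))"
    by (simp add: scaled_\<rho>[OF assms(1)])
  with expands_iff[OF assms(2) v(2), of t] show ?thesis by simp
qed

lemma val_ge_\<rho>:
  assumes "i < n" "val_ge w z"
  shows "val_ge (w - int (e i)) (\<rho> s i z)"
proof -
  have "val_ge 0 (real p powi (int (e i) - w) *\<^sub>R \<rho> s i z)"
    using integral[OF assms(1), of "real p powi (- w) *\<^sub>R z" s] assms(2)
    by (simp only: scaled_\<rho>[OF assms(1)] val_ge_0 val_ge_def[of w])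
  then show ?thesis by (simp add: val_ge_scale)
qed

text \<open>A summand of larger valuation is invisible modulo \<open>p\<close>.\<close>

lemma expands_add:
  assumes "i < n" "expands (e i) (\<rho> s i) y" "has_val v y" "val_ge (v + 1) z"
  shows "expands (e i) (\<rho> s i) (y + z)"
proof -
  have "has_val (v - int (e i)) (\<rho> s i y)" using expandsD[OF assms(2,3)] .
  moreover have "val_ge (v - int (e i) + 1) (\<rho> s i z)"
    using val_ge_\<rho>[OF assms(1,4), of s] by (simp add: algebra_simps)
  ultimately have "has_val (v - int (e i)) (\<rho> s i (y + z))"
    by (simp add: linear_add[OF linear_\<rho>[OF assms(1)]] has_val_add)
  then show ?thesis using has_val_add[OF assms(3,4)] unfolding expands_def by blast
qed

lemma expands_minus: "i < n \<Longrightarrow> expands (e i) (\<rho> s i) (- z) \<longleftrightarrow> expands (e i) (\<rho> s i) z"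
  unfolding expands_def by (simp add: linear_neg[OF linear_\<rho>] has_val_minus)

lemma few_non_expanding:
  assumes "has_val v z"
  shows "card {i. i < n \<and> \<not> expands (e i) (\<rho> False i) z} \<le> 2"
proof -
  let ?z = "real p powi (- v) *\<^sub>R z"
  have "integral_vec ?z" using assms by (simp add: has_val_def val_ge_def)
  moreover have "\<not> divisible_vec ?z"
    using assms unfolding has_val_def by (simp flip: val_ge_1 add: val_ge_scale add.commute)
  ultimately have "card {i. i < n \<and> divisible_vec (real p ^ e i *\<^sub>R \<rho> False i ?z)} \<le> 2"
    by (rule few_contract)
  moreover have "{i. i < n \<and> \<not> expands (e i) (\<rho> False i) z} =
      {i. i < n \<and> divisible_vec (real p ^ e i *\<^sub>R \<rho> False i ?z)}"
    using expands_iff[OF _ assms] by blast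
  ultimately show ?thesis by simp
qed

lemma isometry_\<rho>: "i < n \<Longrightarrow> euclidean_isometry (\<rho> s i)"
proof -
  assume i: "i < n"
  have "bij (\<rho> s i)"
    by (rule o_bij[of "\<rho> (\<not> s) i"]) (use inverse[OF i] inverse[OF i, of "\<not> s"] in \<open>auto simp: fun_eq_iff\<close>)
  moreover have "dist (\<rho> s i x) (\<rho> s i y) = dist x y" for x y
    by (simp add: dist_norm norm_preserving[OF i] flip: linear_diff[OF linear_\<rho>[OF i]])
  ultimately show ?thesis by (simp add: euclidean_isometry_def)
qed

text \<open>Here \<open>z\<close> is the rational vector through which \<open>x\<close> is observed. The last property keeps the valuation
of the chosen preimage different from that of \<open>u\<close>, so that adding \<open>u\<close> cannot cancel leading
terms. Near the origin every label keeps the translate inside the ball.\<close>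

lemma good_label:
  assumes "norm x \<le> 1" "has_val v z"
  obtains i where "i < n" "norm x < 1 / 2 \<or> norm (\<rho> False i x + u) \<le> norm x"
    "expands (e i) (\<rho> False i) z" "\<not> has_val (v - int (e i)) u"
proof -
  define V where "V = {i. i < n \<and> (norm x < 1 / 2 \<or> norm (\<rho> False i x + u) \<le> norm x)}"
  define K where "K = {i. i < n \<and> \<not> expands (e i) (\<rho> False i) z}"
  define T where "T = {i. i < n \<and> has_val (v - int (e i)) u}"
  have fin: "finite V" "finite K" "finite T" by (auto simp: V_def K_def T_def)
  have "card V \<ge> 4"
  proof (cases "norm x < 1 / 2")
    case True
    obtain c :: "real ^ 'n" where "norm c = 1" using vector_choose_size[of 1] by auto
    then have "4 \<le> card {i. i < n \<and> norm (\<rho> False i c + u) \<le> norm c}" by (intro room) auto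
    also have "\<dots> \<le> card {..<n}" by (intro card_mono) auto
    finally show ?thesis using True by (simp add: V_def lessThan_def)
  next
    case False
    then show ?thesis using room[of x] assms(1) by (simp add: V_def)
  qed
  moreover have "card K \<le> 2" unfolding K_def by (rule few_non_expanding[OF assms(2)])
  moreover have "card T \<le> 1"
  proof (rule card_le_Suc0_iff_eq[THEN iffD2, folded One_nat_def, OF fin(3)], intro ballI)
    fix i j assume "i \<in> T" "j \<in> T"
    then have "e i = e j" using has_val_unique unfolding T_def by fastforce
    then show "i = j" using e_inj by (simp add: inj_eq)
  qed
  moreover have "card (K \<union> T) \<le> card K + card T" by (rule card_Un_le)
  ultimately have "card (K \<union> T) < card V" by linarith
  then have "\<not> V \<subseteq> K \<union> T" using card_mono[of "K \<union> T" V] fin by auto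
  then obtain i where "i \<in> V" "i \<notin> K" "i \<notin> T" by blast
  then show ?thesis using that[of i] by (auto simp: V_def K_def T_def)
qed

text \<open>The label of the origin is the translation, the only map under which its preimage is not the origin
itself; every other point gets a linear label. A child reached by a linear letter \<open>i\<close> is contracted
by the inverse of that letter, whereas it is expanded by the inverse of \<open>i\<close> if it is reached in any
other way; this determines the letter from the child.\<close>

theorem divisible:
  fixes B :: "(real ^ 'n) set"
  assumes B: "B = ball 0 1 \<or> B = cball 0 1"
  shows "m_divisible (Suc n) B"
proof -
  obtain \<zeta> :: "real ^ 'n \<Rightarrow> real ^ 'n" where \<zeta>_rational: "\<And>x. rational_vec (\<zeta> x)"
    and \<zeta>_zero: "\<And>x. \<zeta> x = 0 \<longleftrightarrow> x = 0" and \<zeta>_id: "\<And>x. rational_vec x \<Longrightarrow> \<zeta> x = x"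
    and \<zeta>_map: "\<And>f g x. \<lbrakk>rational_map f; rational_map g; \<And>y. g (f y) = y\<rbrakk> \<Longrightarrow> \<zeta> (f x) = f (\<zeta> x)"
    and \<zeta>_add: "\<And>x u. \<lbrakk>rational_vec u; \<not> rational_vec x\<rbrakk> \<Longrightarrow> \<zeta> (x + u) = \<zeta> x"
    using rational_state_map by blast
  have \<zeta>_\<rho>: "\<zeta> (\<rho> s i x) = \<rho> s i (\<zeta> x)" if "i < n" for s i x
    using \<zeta>_map[OF rational[OF that] rational[OF that]] inverse[OF that] by blast
  have val: "\<exists>v. has_val v (\<zeta> x)" if "x \<noteq> 0" for x
    using has_val_exists[OF \<zeta>_rational, of x] \<zeta>_zero that by blast
  have \<zeta>_add_rational: "\<zeta> (x + u) = \<zeta> x + u" if "rational_vec x" for x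
    using that u_rational \<zeta>_id[of x] \<zeta>_id[of "x + u"] by (auto simp: rational_vec_def)
  obtain \<kappa> where \<kappa>: "has_val \<kappa> u" using has_val_exists[OF u_rational u_nonzero] by blast
  have B_mono: "x' \<in> B" if "x \<in> B" "norm x' \<le> norm x" for x x'
    using B that by auto
  have B_inner: "x \<in> B" if "norm x < 1" for x using B that by auto
  have B_norm: "norm x \<le> 1" if "x \<in> B" for x using B that by auto

  define good where "good x i \<longleftrightarrow> i < n \<and> (norm x < 1 / 2 \<or> norm (\<rho> False i x + u) \<le> norm x) \<and>
    expands (e i) (\<rho> False i) (\<zeta> x) \<and> \<not> has_val \<kappa> (\<rho> False i (\<zeta> x))" for x i
  define l where "l x = (if x = 0 then n else SOME i. good x i)" for x
  define y where "y x = (if x = 0 then - u else \<rho> False (l x) x)" for x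
  define f where "f i = (if i < n then \<rho> True i else (\<lambda>x. x + u))" for i
  \<comment> \<open>The origin gets the level infinity: it is nobody's child, and its children may have
    any valuation.\<close>
  define lev :: "real ^ 'n \<Rightarrow> ereal" where
    "lev x = (if x = 0 then \<infinity> else ereal (of_int (THE v. has_val v (\<zeta> x))))" for x
  have lev: "lev x = ereal (of_int v)" if "has_val v (\<zeta> x)" for x v
  proof -
    have "(THE v. has_val v (\<zeta> x)) = v" using that has_val_unique by blast
    moreover have "x \<noteq> 0" using has_val_nonzero[OF that] \<zeta>_zero by blast
    ultimately show ?thesis by (simp add: lev_def)
  qed
  have l_good: "good x (l x)" if "x \<in> B" "x \<noteq> 0" for x
  proof -
    obtain v where v: "has_val v (\<zeta> x)" using val \<open>x \<noteq> 0\<close> by blast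
    obtain i where i: "i < n" "norm x < 1 / 2 \<or> norm (\<rho> False i x + u) \<le> norm x"
      "expands (e i) (\<rho> False i) (\<zeta> x)" "\<not> has_val (v - int (e i)) u"
      using good_label[OF B_norm[OF \<open>x \<in> B\<close>] v] by blast
    have "\<not> has_val \<kappa> (\<rho> False i (\<zeta> x))"
      using expandsD[OF i(3) v] i(4) \<kappa> has_val_unique by metis
    with i have "good x i" by (simp add: good_def)
    then show ?thesis using \<open>x \<noteq> 0\<close> by (simp add: l_def) (rule someI)
  qed
  \<comment> \<open>For a nonzero \<open>x\<close> the letter \<open>i\<close> follows the inverse of another letter, and ping-pong applies; for the origin \<open>u_expands\<close> takes over.\<close>
  have y_expands: "expands (e i) (\<rho> True i) (\<zeta> (y x))" if "x \<in> B" "i < n" "i \<noteq> l x" for x i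
  proof (cases "x = 0")
    case True
    have "rational_vec (- u)" using u_rational by (simp add: rational_vec_def)
    then show ?thesis using True u_expands \<open>i < n\<close> by (simp add: y_def \<zeta>_id expands_minus)
  next
    case False
    with l_good[OF that(1)] have g: "l x < n" "expands (e (l x)) (\<rho> False (l x)) (\<zeta> x)"
      by (auto simp: good_def)
    with expands_step[OF g(1) that(2) _ g(2)] that(3) False show ?thesis
      by (simp add: y_def \<zeta>_\<rho>)
  qed
  \<comment> \<open>In the sum of \<open>y x\<close> and \<open>u\<close> the summand of smaller valuation decides; it is expanded by all inverse letters in either case.\<close>
  have translated: "\<exists>w. has_val w (\<zeta> (y x)) \<and> \<zeta> (y x + u) \<noteq> 0 \<and> (\<exists>w'\<le>w. has_val w' (\<zeta> (y x + u))) \<and>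
      (\<forall>i<n. expands (e i) (\<rho> False i) (\<zeta> (y x + u)))"
    if x: "x \<in> B" "x \<noteq> 0" for x
  proof -
    from l_good[OF that] have g: "l x < n" "expands (e (l x)) (\<rho> False (l x)) (\<zeta> x)"
      "\<not> has_val \<kappa> (\<rho> False (l x) (\<zeta> x))" by (auto simp: good_def)
    define z where "z = \<zeta> (y x)"
    have z: "z = \<rho> False (l x) (\<zeta> x)" using x(2) g(1) by (simp add: z_def y_def \<zeta>_\<rho>)
    obtain v where "has_val v (\<zeta> x)" using val x(2) by blast
    with expandsD[OF g(2)] z obtain w where w: "has_val w z" by blast
    have ex: "expands (e i) (\<rho> False i) z" if "i < n" for i
      using expands_step[OF g(1) that _ g(2), of False] z by simp
    have "(\<exists>w'\<le>w. has_val w' (\<zeta> (y x + u))) \<and> (\<forall>i<n. expands (e i) (\<rho> False i) (\<zeta> (y x + u)))"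
    proof (cases "rational_vec (y x)")
      case False
      then have "\<zeta> (y x + u) = z" using \<zeta>_add u_rational z_def by simp
      then show ?thesis using w ex by auto
    next
      case True
      then have eq: "\<zeta> (y x + u) = z + u" by (simp add: \<zeta>_add_rational z_def)
      have "w \<noteq> \<kappa>" using w g(3) z by auto
      then consider "w + 1 \<le> \<kappa>" | "\<kappa> + 1 \<le> w" by linarith
      then show ?thesis
      proof cases
        case 1
        then have "val_ge (w + 1) u" using \<kappa> val_ge_mono unfolding has_val_def by blast
        then show ?thesis using has_val_add[OF w] expands_add[OF _ ex w] eq by auto
      next
        case 2
        then have "val_ge (\<kappa> + 1) z" using w val_ge_mono unfolding has_val_def by blast
        then have "has_val \<kappa> (u + z)" "i < n \<Longrightarrow> expands (e i) (\<rho> False i) (u + z)" for i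
          using has_val_add[OF \<kappa>] expands_add[OF _ u_expands \<kappa>] by auto
        then show ?thesis using eq 2 by (auto simp: add.commute intro!: exI[of _ \<kappa>])
      qed
    qed
    then show ?thesis using w has_val_nonzero unfolding z_def by blast
  qed
  show ?thesis
  proof (rule divisible_if_children_unique[of "Suc n" f B l y lev])
    show "euclidean_isometry (f i)" if "i < Suc n" for i
    proof (cases "i < n")
      case False
      have "bij (\<lambda>x. x + u)" by (rule o_bij[of "\<lambda>x. x - u"]) (auto simp: fun_eq_iff)
      then show ?thesis using False by (simp add: f_def euclidean_isometry_def)
    qed (simp add: f_def isometry_\<rho>)
  next
    fix x assume x: "x \<in> B"
    show "l x < Suc n \<and> f (l x) (y x) = x"
    proof (cases "x = 0")
      case False
      with l_good[OF x] have "l x < n" by (simp add: good_def)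
      then show ?thesis using False inverse[of "l x" False] by (simp add: f_def y_def)
    qed (simp add: l_def f_def y_def)
  next
    fix x i assume x: "x \<in> B" and i: "i < Suc n"
    show "f i (y x) \<in> B"
    proof (cases "x = 0")
      case True
      have "norm (f i (- u)) < 1"
        using u_small i by (cases "i < n") (auto simp: f_def norm_preserving)
      then show ?thesis using True B_inner by (simp add: y_def)
    next
      case False
      with l_good[OF x] have g: "l x < n" "norm x < 1 / 2 \<or> norm (y x + u) \<le> norm x"
        by (auto simp: good_def y_def)
      have ny: "norm (y x) = norm x" using False g(1) by (simp add: y_def norm_preserving)
      show ?thesis
      proof (cases "i < n")
        case True
        then show ?thesis using B_mono[OF x] ny by (simp add: f_def norm_preserving)
      next
        case F: False
        have "norm x < 1 / 2 \<Longrightarrow> norm (y x + u) < 1"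
          using norm_triangle_ineq[of "y x" u] ny u_small by linarith
        then show ?thesis using F g(2) B_mono[OF x] B_inner by (auto simp: f_def)
      qed
    qed
  next
    fix x i assume x: "x \<in> B" and i: "i < Suc n" "i \<noteq> l x"
    show "lev (f i (y x)) < lev x"
    proof (cases "x = 0")
      case True
      then have "i < n" using i by (simp add: l_def)
      then have "f i (y x) \<noteq> 0"
        using True norm_preserving[of i True "- u"] u_nonzero by (auto simp: f_def y_def)
      then show ?thesis using True by (simp add: lev_def)
    next
      case False
      with l_good[OF x] have g: "l x < n" "expands (e (l x)) (\<rho> False (l x)) (\<zeta> x)" by (auto simp: good_def)
      obtain v where v: "has_val v (\<zeta> x)" using val False by blast
      then have vy: "has_val (v - int (e (l x))) (\<zeta> (y x))"
        using expandsD[OF g(2)] g(1) False by (simp add: y_def \<zeta>_\<rho>)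
      have "\<exists>w < v. has_val w (\<zeta> (f i (y x)))"
      proof (cases "i < n")
        case True
        with expandsD[OF y_expands[OF x True i(2)] vy] have
          "has_val (v - int (e (l x)) - int (e i)) (\<zeta> (f i (y x)))" by (simp add: f_def \<zeta>_\<rho>)
        moreover have "v - int (e (l x)) - int (e i) < v" using e_pos[of i] by simp
        ultimately show ?thesis by blast
      next
        case F: False
        obtain w w' where "has_val w (\<zeta> (y x))" "w' \<le> w" "has_val w' (\<zeta> (y x + u))"
          using translated[OF x False] by blast
        moreover from this have "w = v - int (e (l x))" using vy has_val_unique by blast
        ultimately have "has_val w' (\<zeta> (f i (y x)))" "w' < v"
          using F e_pos[of "l x"] by (auto simp: f_def)
        then show ?thesis by blast
      qed
      then show ?thesis using lev[OF v] lev by auto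
    qed
  next
    fix a b i j
    assume a: "a \<in> B" "i < Suc n" "i \<noteq> l a" and b: "b \<in> B" "j < Suc n" "j \<noteq> l b"
      and eq: "f i (y a) = f j (y b)"
    \<comment> \<open>The two sides of the criterion that identifies the letter: \<open>not_back\<close> for
      the letter itself, \<open>other\<close> for the remaining ones.\<close>
    have not_back: "\<not> expands (e i) (\<rho> False i) (\<zeta> (f i (y a)))"
      if "a \<in> B" "i < n" "i \<noteq> l a" for a i
      using expands_not_back[OF y_expands[OF that], of "\<rho> False i"] inverse[OF that(2), of True] e_pos that(2)
      by (simp add: f_def \<zeta>_\<rho>)
    have other: "expands (e i) (\<rho> False i) (\<zeta> (f j (y b)))"
      if "b \<in> B" "j < Suc n" "j \<noteq> l b" "i < n" "i \<noteq> j" for b i j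
    proof (cases "j < n")
      case True
      then show ?thesis using expands_step[OF True that(4) _ y_expands[OF that(1) True that(3)], of False] that(5)
        by (simp add: f_def \<zeta>_\<rho>)
    next
      case False
      then have "b \<noteq> 0" using that(2,3) by (auto simp: l_def)
      then show ?thesis using translated[OF that(1)] False that(4) by (auto simp: f_def)
    qed
    show "i = j"
    proof (rule ccontr)
      assume "i \<noteq> j"
      then consider "i < n" | "j < n" using a b by linarith
      then show False
      proof cases
        case 1
        then show False using not_back[OF a(1) 1 a(3)] other[OF b 1 \<open>i \<noteq> j\<close>] eq by simp
      next
        case 2
        then show False using not_back[OF b(1) 2 b(3)] other[OF a 2] \<open>i \<noteq> j\<close> eq by simp
      qed
    qed
  qed
qed

end

section \<open>Quaternions and their reduction modulo a prime\<close>

datatype quat = Quat (qw: real) (qx: real) (qy: real) (qz: real)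

lemma quat_eq_iff: "q = r \<longleftrightarrow> qw q = qw r \<and> qx q = qx r \<and> qy q = qy r \<and> qz q = qz r"
  by (cases q; cases r) simp

instantiation quat :: real_algebra_1
begin

definition "0 = Quat 0 0 0 0"
definition "1 = Quat 1 0 0 0"
definition "q + r = Quat (qw q + qw r) (qx q + qx r) (qy q + qy r) (qz q + qz r)"
definition "- q = Quat (- qw q) (- qx q) (- qy q) (- qz q)"
definition "q - r = Quat (qw q - qw r) (qx q - qx r) (qy q - qy r) (qz q - qz r)"
definition "q * r = Quat
  (qw q * qw r - qx q * qx r - qy q * qy r - qz q * qz r)
  (qw q * qx r + qx q * qw r + qy q * qz r - qz q * qy r)
  (qw q * qy r - qx q * qz r + qy q * qw r + qz q * qx r)
  (qw q * qz r + qx q * qy r - qy q * qx r + qz q * qw r)"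
definition "c *\<^sub>R q = Quat (c * qw q) (c * qx q) (c * qy q) (c * qz q)"

instance
  by standard (auto simp: quat_eq_iff zero_quat_def one_quat_def plus_quat_def uminus_quat_def
      minus_quat_def times_quat_def scaleR_quat_def algebra_simps)

end

lemmas quat_ops = zero_quat_def one_quat_def plus_quat_def uminus_quat_def
  minus_quat_def times_quat_def scaleR_quat_def

definition qconj :: "quat \<Rightarrow> quat" where
  "qconj q = Quat (qw q) (- qx q) (- qy q) (- qz q)"

definition qnorm :: "quat \<Rightarrow> real" where
  "qnorm q = (qw q)\<^sup>2 + (qx q)\<^sup>2 + (qy q)\<^sup>2 + (qz q)\<^sup>2"

lemma qconj_mult: "qconj (q * r) = qconj r * qconj q"
  by (simp add: quat_eq_iff qconj_def quat_ops algebra_simps)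

lemma qconj_add: "qconj (q + r) = qconj q + qconj r"
  and qconj_diff: "qconj (q - r) = qconj q - qconj r"
  and qconj_scale: "qconj (c *\<^sub>R q) = c *\<^sub>R qconj q"
  and qconj_qconj [simp]: "qconj (qconj q) = q"
  by (simp_all add: quat_eq_iff qconj_def quat_ops)

lemma qnorm_qconj [simp]: "qnorm (qconj q) = qnorm q"
  by (simp add: qnorm_def qconj_def)

lemma mult_qconj: "q * qconj q = qnorm q *\<^sub>R 1" "qconj q * q = qnorm q *\<^sub>R 1"
  by (simp_all add: quat_eq_iff qconj_def qnorm_def quat_ops power2_eq_square)

lemma qnorm_mult: "qnorm (q * r) = qnorm q * qnorm r"
  by (simp add: qnorm_def quat_ops power2_eq_square algebra_simps)

lemma qnorm_scale: "qnorm (c *\<^sub>R q) = c\<^sup>2 * qnorm q"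
  by (simp add: qnorm_def quat_ops power_mult_distrib algebra_simps)

text \<open>Conjugation is an anti-involution with \<open>c b + (c b)' = 2 Re (c b)\<close>; multiply by \<open>b\<close> on the left. If the norm of
\<open>b\<close> vanishes modulo \<open>p\<close>, this says that the rank-one matrix \<open>b\<close> is reproduced by \<open>b c b\<close> up to the
trace of \<open>c b\<close>, which is what makes ping-pong work.\<close>

lemma quat_sandwich: "b * c * b = (2 * qw (c * b)) *\<^sub>R b - qnorm b *\<^sub>R qconj c"
  by (simp add: quat_eq_iff qconj_def qnorm_def quat_ops power2_eq_square algebra_simps)

lemma quat_square: "b * b = (2 * qw b) *\<^sub>R b - qnorm b *\<^sub>R 1"
  using quat_sandwich[of b 1] by (simp add: quat_eq_iff qconj_def quat_ops)

lemma quat_polarization: "b * qconj c + c * qconj b = (2 * qw (b * qconj c)) *\<^sub>R 1"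
  by (simp add: quat_eq_iff qconj_def quat_ops algebra_simps)

text \<open>The unnormalized letter of a quaternion \<open>b\<close>: it multiplies lengths by \<open>qnorm b\<close>. On
four-dimensional blocks the square of \<open>b\<close> is used, so that the normalizing factor is rational.\<close>

definition act :: "bool \<Rightarrow> quat \<Rightarrow> quat \<Rightarrow> quat" where
  "act four b x = (if four then b * b * x else b * x * qconj b)"

lemma act_add: "act four b (x + y) = act four b x + act four b y"
  by (simp add: act_def algebra_simps)

lemma act_scale: "act four b (c *\<^sub>R x) = c *\<^sub>R act four b x"
  by (simp add: act_def)

lemma act_scale_left: "act four (c *\<^sub>R b) x = c\<^sup>2 *\<^sub>R act four b x"
  by (simp add: act_def qconj_scale power2_eq_square)

lemma qnorm_act: "qnorm (act four b x) = (qnorm b)\<^sup>2 * qnorm x"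
  by (simp add: act_def qnorm_mult power2_eq_square)

lemma act_conj: "act four (qconj b) (act four b x) = (qnorm b)\<^sup>2 *\<^sub>R x"
proof -
  have 1: "qconj b * (b * y) = qnorm b *\<^sub>R y" for y
    by (simp add: mult.assoc[symmetric] mult_qconj)
  have 2: "y * qconj b * b = qnorm b *\<^sub>R y" for y
    by (simp add: mult.assoc mult_qconj)
  show ?thesis
  proof (cases four)
    case True
    then have "act four (qconj b) (act four b x) = qconj b * (qconj b * (b * (b * x)))"
      by (simp add: act_def mult.assoc)
    then show ?thesis by (simp add: 1 power2_eq_square)
  next
    case False
    then have "act four (qconj b) (act four b x) = (qconj b * (b * x)) * qconj b * b"
      by (simp add: act_def mult.assoc)
    then show ?thesis by (simp add: 1 2 power2_eq_square)
  qed
qed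

lemma act_pure: "qw x = 0 \<Longrightarrow> qw (act False b x) = 0"
  by (simp add: act_def qconj_def quat_ops algebra_simps)

context prime_place begin

definition integral_quat :: "quat \<Rightarrow> bool" where
  "integral_quat q \<longleftrightarrow> integral_at (qw q) \<and> integral_at (qx q) \<and> integral_at (qy q) \<and> integral_at (qz q)"

definition divisible_quat :: "quat \<Rightarrow> bool" where
  "divisible_quat q \<longleftrightarrow> divisible_at (qw q) \<and> divisible_at (qx q) \<and> divisible_at (qy q) \<and> divisible_at (qz q)"

lemma integral_quat_simps:
  "integral_quat q \<Longrightarrow> integral_quat r \<Longrightarrow> integral_quat (q + r)"
  "integral_quat q \<Longrightarrow> integral_quat r \<Longrightarrow> integral_quat (q - r)"
  "integral_quat q \<Longrightarrow> integral_quat r \<Longrightarrow> integral_quat (q * r)"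
  "integral_quat q \<Longrightarrow> integral_quat (qconj q)"
  "integral_at c \<Longrightarrow> integral_quat q \<Longrightarrow> integral_quat (c *\<^sub>R q)"
  "integral_quat 1"
  unfolding integral_quat_def
  by (auto simp: quat_ops qconj_def intro!: integral_intros)

lemma integral_act: "integral_quat b \<Longrightarrow> integral_quat x \<Longrightarrow> integral_quat (act four b x)"
  by (simp add: act_def integral_quat_simps)

lemma integral_qnorm: "integral_quat q \<Longrightarrow> integral_at (qnorm q)"
  unfolding integral_quat_def qnorm_def by (intro integral_intros) auto

lemma divisible_quat_ideal:
  "divisible_quat q \<Longrightarrow> divisible_quat r \<Longrightarrow> divisible_quat (q + r)"
  "divisible_quat q \<Longrightarrow> divisible_quat r \<Longrightarrow> divisible_quat (q - r)"
  "divisible_quat q \<Longrightarrow> integral_quat r \<Longrightarrow> divisible_quat (q * r)"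
  "divisible_quat q \<Longrightarrow> integral_quat r \<Longrightarrow> divisible_quat (r * q)"
  "divisible_quat q \<Longrightarrow> divisible_quat (qconj q)"
  "integral_at c \<Longrightarrow> divisible_quat q \<Longrightarrow> divisible_quat (c *\<^sub>R q)"
  "divisible_at c \<Longrightarrow> integral_quat q \<Longrightarrow> divisible_quat (c *\<^sub>R q)"
  unfolding divisible_quat_def integral_quat_def
  by (auto simp: quat_ops qconj_def intro!: divisible_add divisible_diff divisible_minus
      intro: divisible_mult)

lemma divisible_quat_cancel_add:
  assumes "divisible_quat r" shows "divisible_quat (q + r) \<longleftrightarrow> divisible_quat q"
    "divisible_quat (q - r) \<longleftrightarrow> divisible_quat q"
  using assms divisible_quat_ideal(1,2) by (metis add_diff_cancel_right', metis diff_add_cancel)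

lemma divisible_quat_scale_cancel:
  "\<lbrakk>integral_at c; integral_quat q; divisible_quat (c *\<^sub>R q); \<not> divisible_at c\<rbrakk> \<Longrightarrow> divisible_quat q"
  unfolding divisible_quat_def integral_quat_def using divisible_prime[of c]
  by (auto simp: quat_ops)

lemma divisible_cancel: "\<lbrakk>integral_at r; integral_at s; divisible_at (r * s); \<not> divisible_at r\<rbrakk> \<Longrightarrow> divisible_at s"
  using divisible_prime by blast

lemma two_not_divisible: "odd p \<Longrightarrow> \<not> divisible_at 2"
proof
  assume "odd p" "divisible_at 2"
  then have "int p dvd 2" using divisible_of_int[of 2] by simp
  then have "int p \<le> 2" by (rule zdvd_imp_le) simp
  with \<open>odd p\<close> prime show False using prime_gt_1_nat[OF prime] by (cases "p = 2") auto
qed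

lemma integral_comps: "integral_quat q \<Longrightarrow> integral_at (qw q)"
  by (simp add: integral_quat_def)

lemma not_divisible_mult:
  "\<lbrakk>integral_at r; integral_at s; \<not> divisible_at r; \<not> divisible_at s\<rbrakk> \<Longrightarrow> \<not> divisible_at (r * s)"
  using divisible_prime by blast

text \<open>If the letter of \<open>c\<close> annihilated the image of \<open>x\<close> under the letter of \<open>b\<close> modulo \<open>p\<close>, multiplication by
\<open>b\<close> would turn \<open>c\<close> into \<open>b c b\<close>, that is, into a unit multiple of \<open>b\<close> by \<open>quat_sandwich\<close>, so \<open>b\<close> would
annihilate \<open>x\<close> too. The unit is the trace of \<open>c b\<close>.\<close>

lemma act_keeps_expanding:
  assumes p: "odd p" and int: "integral_quat b" "integral_quat c" "integral_quat x"
    and norms: "divisible_at (qnorm b)" "divisible_at (qnorm c)"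
    and cb: "\<not> divisible_at (qw (c * b))" and c: "\<not> divisible_at (qw c)"
    and b: "\<not> divisible_quat (act four b x)"
  shows "\<not> divisible_quat (act four c (act four b x))"
proof
  assume div: "divisible_quat (act four c (act four b x))"
  define t where "t = 2 * qw (c * b)"
  have t: "integral_at t" "\<not> divisible_at t"
    using not_divisible_mult[OF _ _ two_not_divisible[OF p] cb] int
    by (auto simp: t_def intro!: integral_mult integral_comps integral_quat_simps)
  have tc: "integral_at (2 * qw c)" "\<not> divisible_at (2 * qw c)"
    using not_divisible_mult[OF _ _ two_not_divisible[OF p] c] int
    by (auto intro!: integral_mult integral_comps integral_quat_simps)
  define D where "D = qnorm b *\<^sub>R qconj c"
  have D: "divisible_quat D" "integral_quat D"
    unfolding D_def using norms int by (auto intro!: divisible_quat_ideal integral_quat_simps integral_qnorm)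
  have bcb: "b * c * b = t *\<^sub>R b - D" by (simp add: quat_sandwich t_def D_def)
  show False
  proof (cases four)
    case False
    have "divisible_quat (b * act four c (act four b x) * qconj b)"
      using div int by (blast intro: divisible_quat_ideal(3,4) integral_quat_simps(4))
    also have "b * act four c (act four b x) * qconj b = (b * c * b) * x * qconj (b * c * b)"
      using False by (simp add: act_def qconj_mult mult.assoc)
    also have "\<dots> = t\<^sup>2 *\<^sub>R act four b x - (D * x * qconj (t *\<^sub>R b - D) + t *\<^sub>R b * x * qconj D)"
      using False unfolding bcb
      by (simp add: act_def qconj_diff qconj_scale algebra_simps power2_eq_square)
    finally have d: "divisible_quat (t\<^sup>2 *\<^sub>R act four b x -
      (D * x * qconj (t *\<^sub>R b - D) + t *\<^sub>R b * x * qconj D))" .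
    have "divisible_quat (D * x * qconj (t *\<^sub>R b - D) + t *\<^sub>R b * x * qconj D)"
      by (intro divisible_quat_ideal(1) divisible_quat_ideal(3)[OF divisible_quat_ideal(3)]
          divisible_quat_ideal(4)[OF divisible_quat_ideal(5)] integral_quat_simps D int t)
    with d have "divisible_quat (t\<^sup>2 *\<^sub>R act four b x)"
      by (simp only: divisible_quat_cancel_add(2))
    moreover have "\<not> divisible_at (t\<^sup>2)"
      using not_divisible_mult[OF t(1,1,2,2)] by (simp add: power2_eq_square)
    ultimately show False
      using b int t(1) divisible_quat_scale_cancel[of "t\<^sup>2"] integral_act integral_power by blast
  next
    case True
    have "act four c (act four b x) = (2 * qw c) *\<^sub>R (c * (b * (b * x))) - qnorm c *\<^sub>R (b * (b * x))"
      using True by (simp add: act_def quat_square[of c] mult.assoc[symmetric] left_diff_distrib)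
    moreover have "divisible_quat (qnorm c *\<^sub>R (b * (b * x)))"
      using norms(2) int by (intro divisible_quat_ideal(7) integral_quat_simps)
    ultimately have "divisible_quat ((2 * qw c) *\<^sub>R (c * (b * (b * x))))"
      using div divisible_quat_cancel_add(2) by metis
    moreover have "integral_quat (c * (b * (b * x)))" using int by (intro integral_quat_simps)
    ultimately have "divisible_quat (c * (b * (b * x)))"
      using divisible_quat_scale_cancel tc by blast
    then have "divisible_quat (b * (c * (b * (b * x))))"
      by (rule divisible_quat_ideal(4)[OF _ int(1)])
    also have "b * (c * (b * (b * x))) = (b * c * b) * (b * x)" by (simp add: mult.assoc)
    also have "\<dots> = t *\<^sub>R act four b x - D * (b * x)"
      using True unfolding bcb by (simp add: act_def algebra_simps)
    finally have "divisible_quat (t *\<^sub>R act four b x - D * (b * x))" .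
    moreover have "divisible_quat (D * (b * x))"
      using D int by (intro divisible_quat_ideal(3) integral_quat_simps)
    ultimately have "divisible_quat (t *\<^sub>R act four b x)"
      by (simp only: divisible_quat_cancel_add(2))
    with b t int divisible_quat_scale_cancel[of t] integral_act show False by blast
  qed
qed

text \<open>On four-dimensional blocks the kernels of two different inverse letters meet only in \<open>0\<close>: both
conjugates annihilate \<open>x\<close>, hence so does their polarized norm form, a unit.\<close>

lemma contract_four_unique:
  assumes p: "odd p" and int: "integral_quat b" "integral_quat c" "integral_quat x"
    and norms: "divisible_at (qnorm b)" "divisible_at (qnorm c)"
    and bc: "\<not> divisible_at (qw (b * qconj c))" and w: "\<not> divisible_at (qw b)" "\<not> divisible_at (qw c)"
    and div: "divisible_quat (act True (qconj b) x)" "divisible_quat (act True (qconj c) x)"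
  shows "divisible_quat x"
proof -
  have *: "divisible_quat (qconj a * x)"
    if "integral_quat a" "divisible_at (qnorm a)" "\<not> divisible_at (qw a)"
      "divisible_quat (act True (qconj a) x)" for a
  proof -
    have w': "qw (qconj a) = qw a" by (simp add: qconj_def)
    have "act True (qconj a) x = (2 * qw a) *\<^sub>R (qconj a * x) - qnorm a *\<^sub>R x"
      by (simp add: act_def quat_square[of "qconj a"] w' left_diff_distrib)
    moreover have "divisible_quat (qnorm a *\<^sub>R x)" using that int by (intro divisible_quat_ideal(7))
    ultimately have "divisible_quat ((2 * qw a) *\<^sub>R (qconj a * x))"
      using that(4) divisible_quat_cancel_add(2) by metis
    moreover have "\<not> divisible_at (2 * qw a)" "integral_at (2 * qw a)"
      using not_divisible_mult[OF _ _ two_not_divisible[OF p] that(3)] that(1)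
      by (auto intro!: integral_mult integral_comps)
    moreover have "integral_quat (qconj a * x)" using that(1) int by (intro integral_quat_simps)
    ultimately show ?thesis using divisible_quat_scale_cancel by blast
  qed
  have "divisible_quat (b * (qconj c * x) + c * (qconj b * x))"
    using *[OF int(1) norms(1) w(1) div(1)] *[OF int(2) norms(2) w(2) div(2)] int
    by (intro divisible_quat_ideal(1) divisible_quat_ideal(4)[of "_ * x"])
  also have "b * (qconj c * x) + c * (qconj b * x) = (b * qconj c + c * qconj b) * x"
    by (simp add: algebra_simps)
  also have "\<dots> = (2 * qw (b * qconj c)) *\<^sub>R x" by (simp add: quat_polarization)
  finally have "divisible_quat ((2 * qw (b * qconj c)) *\<^sub>R x)" .
  moreover have "\<not> divisible_at (2 * qw (b * qconj c))" "integral_at (2 * qw (b * qconj c))"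
    using not_divisible_mult[OF _ _ two_not_divisible[OF p] bc] int
    by (auto intro!: integral_mult integral_comps integral_quat_simps)
  ultimately show ?thesis using divisible_quat_scale_cancel int by blast
qed

text \<open>With \<open>\<iota>\<^sup>2 = - 1\<close> modulo \<open>p\<close>, quaternions modulo \<open>p\<close> are \<open>2 \<times> 2\<close> matrices: \<open>w + x i + y j + z k\<close> has the
rows \<open>(w + \<iota> x, y + \<iota> z)\<close> and \<open>(- y + \<iota> z, w - \<iota> x)\<close>. The quaternion below is \<open>2 \<iota>\<close> times a rank-one
matrix whose image is spanned by \<open>(1, l)\<close> and whose kernel is spanned by \<open>(1, m)\<close>. Conjugation exchanges the two
lines up to sign.\<close>

definition residue :: "real \<Rightarrow> real \<Rightarrow> real \<Rightarrow> quat" where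
  "residue \<iota> l m = Quat (\<iota> * (m - l)) (l + m) (- \<iota> * (1 + l * m)) (l * m - 1)"

text \<open>The free sign makes the notion symmetric under conjugation, which exchanges the two ends.\<close>

definition has_ends :: "real \<Rightarrow> real \<Rightarrow> real \<Rightarrow> quat \<Rightarrow> bool" where
  "has_ends \<iota> l m b \<longleftrightarrow> (\<exists>\<sigma>\<in>{1, - 1}. divisible_quat (b - \<sigma> *\<^sub>R residue \<iota> l m))"

lemma residue_conj: "qconj (residue \<iota> l m) = - residue \<iota> m l"
  by (simp add: residue_def qconj_def quat_ops algebra_simps)

lemma has_ends_conj:
  assumes "has_ends \<iota> l m b" shows "has_ends \<iota> m l (qconj b)"
proof -
  from assms obtain \<sigma> where \<sigma>: "\<sigma> \<in> {1, - 1}" "divisible_quat (b - \<sigma> *\<^sub>R residue \<iota> l m)"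
    unfolding has_ends_def by blast
  have "qconj (b - \<sigma> *\<^sub>R residue \<iota> l m) = qconj b - (- \<sigma>) *\<^sub>R residue \<iota> m l"
    by (simp add: qconj_diff qconj_scale residue_conj)
  with divisible_quat_ideal(5)[OF \<sigma>(2)] \<sigma>(1) show ?thesis unfolding has_ends_def by fastforce
qed

text \<open>The trace of a product of rank-one matrices vanishes modulo \<open>p\<close> exactly if the image of one factor is
the kernel of the other.\<close>

lemma qw_residue_mult: "qw (residue \<iota> l m * residue \<iota> l' m') =
    2 * ((m - l') * (l - m')) + (\<iota>\<^sup>2 + 1) * ((m - l) * (m' - l') - (1 + l * m) * (1 + l' * m'))"
  by (simp add: residue_def quat_ops power2_eq_square algebra_simps)

text \<open>For an imaginary \<open>x\<close>, seen as a traceless \<open>2 \<times> 2\<close> matrix modulo \<open>p\<close>, this is the determinant of the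
columns \<open>(1, l)\<close> and \<open>x (1, l)\<close>, up to sign; it vanishes exactly if \<open>(1, l)\<close> is an eigenvector.\<close>

definition end_form :: "real \<Rightarrow> quat \<Rightarrow> real \<Rightarrow> real" where
  "end_form \<iota> x l = 2 * \<iota> * qx x * l + (qy x + \<iota> * qz x) * l\<^sup>2 + (qy x - \<iota> * qz x)"

context
  fixes \<iota> :: real
  assumes \<iota>: "integral_at \<iota>" "divisible_at (\<iota>\<^sup>2 + 1)" and p_odd: "odd p"
begin

lemma integral_residue: "integral_at l \<Longrightarrow> integral_at m \<Longrightarrow> integral_quat (residue \<iota> l m)"
  using \<iota> by (auto simp: residue_def integral_quat_def intro!: integral_intros)

lemma has_ends_integral:
  assumes "integral_at l" "integral_at m" "has_ends \<iota> l m b" shows "integral_quat b"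
proof -
  from assms(3) obtain \<sigma> where \<sigma>: "\<sigma> \<in> {1, - 1}" "divisible_quat (b - \<sigma> *\<^sub>R residue \<iota> l m)"
    unfolding has_ends_def by blast
  then have "integral_quat (b - \<sigma> *\<^sub>R residue \<iota> l m)"
    using divisible_imp_integral unfolding divisible_quat_def integral_quat_def by blast
  moreover have "integral_quat (\<sigma> *\<^sub>R residue \<iota> l m)"
    using \<sigma>(1) integral_of_int[of "- 1"] assms by (intro integral_quat_simps integral_residue) auto
  ultimately show ?thesis using integral_quat_simps(1) by fastforce
qed

lemma \<iota>_not_divisible: "\<not> divisible_at \<iota>"
proof
  assume "divisible_at \<iota>"
  then have "divisible_at (\<iota>\<^sup>2)" using \<iota>(1) by (simp add: power2_eq_square divisible_mult)
  from divisible_diff[OF \<iota>(2) this] have "int p dvd 1" using divisible_of_int[of 1] by simp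
  then show False using prime_int not_prime_unit by blast
qed

lemma qw_mult_divisible:
  assumes int: "integral_at l" "integral_at m" "integral_at l'" "integral_at m'"
    and c: "has_ends \<iota> l m c" and b: "has_ends \<iota> l' m' b"
    and ne: "\<not> divisible_at (m - l')" "\<not> divisible_at (l - m')"
  shows "\<not> divisible_at (qw (c * b))"
proof
  assume div: "divisible_at (qw (c * b))"
  from b c obtain \<sigma> \<tau> where \<sigma>: "\<sigma> \<in> {1, - 1}" "divisible_quat (c - \<sigma> *\<^sub>R residue \<iota> l m)"
    and \<tau>: "\<tau> \<in> {1, - 1}" "divisible_quat (b - \<tau> *\<^sub>R residue \<iota> l' m')"
    unfolding has_ends_def by blast
  have sg: "integral_at \<sigma>" "integral_at \<tau>" using \<sigma>(1) \<tau>(1) integral_of_int[of "- 1"] by auto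
  let ?r = "residue \<iota> l m" and ?s = "residue \<iota> l' m'"
  have res: "integral_quat ?r" "integral_quat ?s" using int by (auto intro: integral_residue)
  have "divisible_quat ((c - \<sigma> *\<^sub>R ?r) * b + (\<sigma> *\<^sub>R ?r) * (b - \<tau> *\<^sub>R ?s))"
    using \<sigma>(2) \<tau>(2) sg res has_ends_integral[OF int(3,4) b]
    by (blast intro: divisible_quat_ideal(1,3,4) integral_quat_simps(5))
  also have "(c - \<sigma> *\<^sub>R ?r) * b + (\<sigma> *\<^sub>R ?r) * (b - \<tau> *\<^sub>R ?s) = c * b - (\<sigma> * \<tau>) *\<^sub>R (?r * ?s)"
    by (simp add: algebra_simps)
  finally have "divisible_at (qw (c * b) - \<sigma> * \<tau> * qw (?r * ?s))"
    unfolding divisible_quat_def by (simp add: minus_quat_def scaleR_quat_def)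
  from divisible_mult(2)[OF divisible_diff[OF div this] integral_mult[OF sg]]
  have "divisible_at (qw (?r * ?s))" using \<sigma>(1) \<tau>(1) by auto
  moreover have "divisible_at ((\<iota>\<^sup>2 + 1) * ((m - l) * (m' - l') - (1 + l * m) * (1 + l' * m')))"
    using \<iota> int by (intro divisible_mult(1) integral_intros) auto
  ultimately have "divisible_at (2 * ((m - l') * (l - m')))"
    using divisible_diff unfolding qw_residue_mult by fastforce
  moreover have "\<not> divisible_at (2 * ((m - l') * (l - m')))"
    using int ne two_not_divisible[OF p_odd]
    by (intro not_divisible_mult integral_intros) auto
  ultimately show False by blast
qed

lemma qw_not_divisible:
  assumes int: "integral_at l" "integral_at m" and b: "has_ends \<iota> l m b"
    and ne: "\<not> divisible_at (m - l)"
  shows "\<not> divisible_at (qw b)"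
proof
  assume div: "divisible_at (qw b)"
  from b obtain \<sigma> where \<sigma>: "\<sigma> \<in> {1, - 1}" "divisible_at (qw b - \<sigma> * (\<iota> * (m - l)))"
    unfolding has_ends_def divisible_quat_def by (auto simp only: minus_quat_def scaleR_quat_def residue_def quat.sel)
  have "divisible_at (\<sigma> * (\<iota> * (m - l)))" using divisible_diff[OF div \<sigma>(2)] by simp
  then have "divisible_at (\<iota> * (m - l))" using \<sigma>(1) divisible_minus by fastforce
  then show False using not_divisible_mult[OF _ _ \<iota>_not_divisible ne] \<iota> int
    by (auto intro: integral_intros)
qed

text \<open>On three-dimensional blocks the inverse letter of \<open>b\<close> annihilates \<open>x\<close> modulo \<open>p\<close> only if the image
\<open>(1, l)\<close> of \<open>b\<close> is mapped by \<open>x\<close> into the kernel \<open>(1, l)\<close> of the conjugate of \<open>b\<close>. In the proof, \<open>h\<close> is the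
quotient by \<open>\<iota>\<^sup>2 + 1\<close> of the difference between a matrix entry of the product and \<open>- 4\<close> times the form.\<close>

lemma contract_three_end_form:
  assumes int: "integral_at l" "integral_at m" and b: "has_ends \<iota> l m b"
    and x: "integral_quat x" "qw x = 0" and div: "divisible_quat (act False (qconj b) x)"
  shows "divisible_at (end_form \<iota> x l)"
proof -
  from b obtain \<sigma> where \<sigma>: "\<sigma> \<in> {1, - 1}" "divisible_quat (b - \<sigma> *\<^sub>R residue \<iota> l m)"
    unfolding has_ends_def by blast
  define r where "r = \<sigma> *\<^sub>R residue \<iota> l m"
  have r: "integral_quat r" "divisible_quat (b - r)"
    using \<sigma> integral_of_int[of "- 1"] int unfolding r_def
    by (auto intro!: integral_quat_simps integral_residue)
  have "divisible_quat (qconj b * x * b - (qconj (b - r) * x * b + qconj r * x * (b - r)))"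
    using div r x(1) has_ends_integral[OF int b] unfolding act_def
    by (auto intro!: divisible_quat_ideal(1,2) intro: divisible_quat_ideal(3-5) integral_quat_simps)
  also have "qconj b * x * b - (qconj (b - r) * x * b + qconj r * x * (b - r)) = qconj r * x * r"
    by (simp add: qconj_diff algebra_simps)
  also have "qconj r * x * r = qconj (residue \<iota> l m) * x * residue \<iota> l m"
    using \<sigma>(1) by (auto simp: r_def qconj_scale)
  finally have d: "divisible_quat (qconj (residue \<iota> l m) * x * residue \<iota> l m)" (is "divisible_quat ?q") .
  then have "divisible_at (qy ?q + \<iota> * qz ?q)"
    using \<iota> unfolding divisible_quat_def by (intro divisible_add divisible_mult) auto
  moreover define h where "h = \<iota> * (2 * (l\<^sup>2 * m * qx x) - l\<^sup>2 * m\<^sup>2 * qz x + l\<^sup>2 * qz x - 2 * (l * m\<^sup>2 * qx x)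
      - 4 * (l * m * qz x) + 2 * (l * qx x) + m\<^sup>2 * qz x - 2 * (m * qx x) - qz x)
    + (3 * (l\<^sup>2 * qy x) - l\<^sup>2 * m\<^sup>2 * qy x - m\<^sup>2 * qy x + 3 * qy x)"
  moreover have "integral_at h"
    unfolding h_def using \<iota>(1) int x(1) unfolding integral_quat_def by (intro integral_intros) auto
  moreover have "qy ?q + \<iota> * qz ?q = - 4 * end_form \<iota> x l + (\<iota>\<^sup>2 + 1) * h"
    using x(2) by (simp add: h_def end_form_def residue_def qconj_def times_quat_def)
      (simp add: power2_eq_square algebra_simps)
  ultimately have "divisible_at (- 4 * end_form \<iota> x l)"
    using divisible_diff[of _ "(\<iota>\<^sup>2 + 1) * h"] divisible_mult(1)[OF \<iota>(2), of h] by fastforce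
  moreover have "\<not> divisible_at (- 4)" 
    using not_divisible_mult[OF _ _ two_not_divisible[OF p_odd] two_not_divisible[OF p_odd]] divisible_minus[of "- 4"]
    by auto
  moreover have "integral_at (end_form \<iota> x l)"
    unfolding end_form_def using \<iota> int x(1) unfolding integral_quat_def by (intro integral_intros) auto
  ultimately show ?thesis using divisible_cancel[of "- 4"] integral_of_int[of "- 4"] by auto
qed

text \<open>A quadratic polynomial with three roots modulo \<open>p\<close> is zero. Hence at most two inverse letters
contract a given vector.\<close>

lemma end_form_three_roots:
  assumes x: "integral_quat x" "qw x = 0"
    and int: "integral_at l1" "integral_at l2" "integral_at l3"
    and ne: "\<not> divisible_at (l1 - l2)" "\<not> divisible_at (l1 - l3)" "\<not> divisible_at (l2 - l3)"
    and div: "divisible_at (end_form \<iota> x l1)" "divisible_at (end_form \<iota> x l2)" "divisible_at (end_form \<iota> x l3)"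
  shows "divisible_quat x"
proof -
  define A where "A = qy x + \<iota> * qz x"
  define C where "C = 2 * \<iota> * qx x"
  have ix: "integral_at (qx x)" "integral_at (qy x)" "integral_at (qz x)"
    using x by (auto simp: integral_quat_def)
  have AC: "integral_at A" "integral_at C" using ix \<iota> by (auto simp: A_def C_def intro!: integral_intros)
  have two: "\<not> divisible_at 2" using two_not_divisible[OF p_odd] .
  have diff: "divisible_at (C + A * (l + l'))"
    if "divisible_at (end_form \<iota> x l)" "divisible_at (end_form \<iota> x l')" "\<not> divisible_at (l - l')"
      "integral_at l" "integral_at l'" for l l'
  proof (rule divisible_cancel[of "l - l'"])
    have "(l - l') * (C + A * (l + l')) = end_form \<iota> x l - end_form \<iota> x l'"
      by (simp add: end_form_def A_def C_def power2_eq_square algebra_simps)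
    then show "divisible_at ((l - l') * (C + A * (l + l')))" using divisible_diff that by simp
  qed (use that AC in \<open>auto intro!: integral_intros\<close>)
  have A: "divisible_at A"
  proof (rule divisible_cancel[of "l2 - l3"])
    have "(l2 - l3) * A = (C + A * (l1 + l2)) - (C + A * (l1 + l3))" by (simp add: algebra_simps)
    then show "divisible_at ((l2 - l3) * A)" using diff div ne int divisible_diff by presburger
  qed (use ne int AC in \<open>auto intro!: integral_intros\<close>)
  have "C = (C + A * (l1 + l2)) - A * (l1 + l2)" by simp
  then have C: "divisible_at C"
    using diff[OF div(1,2) ne(1) int(1,2)] divisible_diff divisible_mult(1)[OF A integral_add[OF int(1,2)]]
    by metis
  have "qy x - \<iota> * qz x = end_form \<iota> x l1 - C * l1 - A * (l1 * l1)"
    by (simp add: end_form_def A_def C_def power2_eq_square)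
  moreover have "divisible_at (end_form \<iota> x l1 - C * l1 - A * (l1 * l1))"
    using div(1) A C int by (intro divisible_diff divisible_mult(1) integral_mult)
  ultimately have E: "divisible_at (qy x - \<iota> * qz x)" by simp
  have "divisible_at (2 * qy x)" using divisible_add[OF A E] by (simp add: A_def)
  then have y: "divisible_at (qy x)" using divisible_cancel[OF _ ix(2) _ two] by simp
  have "divisible_at (\<iota> * qz x)" using divisible_diff[OF A y] by (simp add: A_def)
  then have z: "divisible_at (qz x)" using divisible_cancel[OF \<iota>(1) ix(3) _ \<iota>_not_divisible] by simp
  have "divisible_at (2 * (\<iota> * qx x))" using C by (simp add: C_def mult.assoc)
  then have "divisible_at (\<iota> * qx x)"
    using divisible_cancel[OF _ _ _ two] integral_mult[OF \<iota>(1) ix(1)] by simp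
  then have "divisible_at (qx x)" using divisible_cancel[OF \<iota>(1) ix(1) _ \<iota>_not_divisible] by simp
  with x(2) y z show ?thesis by (simp add: divisible_quat_def)
qed

end
end

text \<open>Newton steps raise the power of \<open>p\<close>; if in the end the power is too high, one more change of \<open>v\<close> by
\<open>p ^ Suc e\<close> brings it down, because \<open>2 v\<close> is a unit. An exact power is needed since the norm of a
quaternion is the denominator of its letter.\<close>

lemma hensel_square_exact:
  fixes p w R :: int
  assumes p: "prime p" "odd p" and w: "\<not> p dvd w" and R: "p dvd w\<^sup>2 + R"
  shows "\<exists>v. p dvd v - w \<and> p ^ Suc e dvd v\<^sup>2 + R \<and> \<not> p ^ Suc (Suc e) dvd v\<^sup>2 + R"
proof -
  have lift: "\<exists>v. p dvd v - w \<and> p ^ Suc e dvd v\<^sup>2 + R" for e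
  proof (induction e)
    case 0
    then show ?case using R by (intro exI[of _ w]) simp
  next
    case (Suc e)
    then obtain v k where v: "p dvd v - w" "v\<^sup>2 + R = p ^ Suc e * k" unfolding dvd_def by blast
    have "\<not> p dvd v" using v(1) w by (metis dvd_diff_commute dvd_diff dvd_add_right_iff diff_add_cancel)
    moreover have "\<not> p dvd 2" using p prime_ge_2_int[OF p(1)] zdvd_imp_le[of p 2] by (cases "p = 2") auto
    ultimately have "\<not> p dvd 2 * v" using p(1) by (simp add: prime_dvd_mult_iff)
    then have "coprime (2 * v) p" using p(1) prime_imp_coprime coprime_commute by blast
    then obtain a b where "a * (2 * v) + b * p = 1" using bezout_int[of "2 * v" p] by auto
    then have inv: "1 - a * (2 * v) = b * p" by simp
    have "k + 2 * v * (- k * a) = k * (1 - a * (2 * v))" by (simp add: algebra_simps)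
    then have c: "p dvd k + 2 * v * (- k * a)" by (simp add: inv)
    define c' where "c' = - k * a"
    have "(v + p ^ Suc e * c')\<^sup>2 + R = p ^ Suc e * (k + 2 * v * c') + p ^ Suc (Suc e) * (p ^ e * c'\<^sup>2)"
      using v(2) by (simp add: power2_eq_square algebra_simps)
    moreover have "p ^ Suc (Suc e) dvd p ^ Suc e * (k + 2 * v * c')"
      using c mult_dvd_mono[of "p ^ Suc e" "p ^ Suc e" p] by (simp add: c'_def mult.commute)
    ultimately have "p ^ Suc (Suc e) dvd (v + p ^ Suc e * c')\<^sup>2 + R" by simp
    moreover have "p dvd (v + p ^ Suc e * c') - w"
      using v(1) by (metis add_diff_eq dvd_add dvd_mult2 dvd_triv_left power_Suc add.commute diff_add_eq)
    ultimately show ?case by blast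
  qed
  obtain v where v: "p dvd v - w" "p ^ Suc e dvd v\<^sup>2 + R" using lift by blast
  show ?thesis
  proof (cases "p ^ Suc (Suc e) dvd v\<^sup>2 + R")
    case False
    with v show ?thesis by blast
  next
    case True
    define v' where "v' = v + p ^ Suc e"
    have eq: "v'\<^sup>2 + R = (v\<^sup>2 + R) + p ^ Suc e * (2 * v) + p ^ Suc (Suc e) * p ^ e"
      by (simp add: v'_def power2_eq_square algebra_simps)
    have "\<not> p dvd v" using v(1) w by (metis dvd_diff_commute dvd_diff dvd_add_right_iff diff_add_cancel)
    moreover have "\<not> p dvd 2" using p prime_ge_2_int[OF p(1)] zdvd_imp_le[of p 2] by (cases "p = 2") auto
    ultimately have "\<not> p dvd 2 * v" using p(1) by (simp add: prime_dvd_mult_iff)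
    then have "\<not> p ^ Suc (Suc e) dvd p ^ Suc e * (2 * v)"
      using p(1) by (simp add: power_Suc2 del: power_Suc)
    then have "\<not> p ^ Suc (Suc e) dvd v'\<^sup>2 + R"
      unfolding eq using True by (simp add: dvd_add_right_iff dvd_add_left_iff)
    moreover have "p ^ Suc e dvd v'\<^sup>2 + R"
      using v(2) unfolding eq by (rule dvd_add[OF dvd_add]) auto
    moreover have "p dvd v' - w"
    proof -
      have "v' - w = (v - w) + p * p ^ e" by (simp add: v'_def)
      then show ?thesis using v(1) by (metis dvd_add dvd_triv_left)
    qed
    ultimately show ?thesis by blast
  qed
qed

section \<open>Coordinates in quaternionic blocks\<close>

definition qc :: "nat \<Rightarrow> quat \<Rightarrow> real" where
  "qc c q = (if c = 0 then qw q else if c = 1 then qx q else if c = 2 then qy q else qz q)"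

lemma qc_simps: "qc 0 q = qw q" "qc 1 q = qx q" "qc 2 q = qy q" "qc 3 q = qz q"
  by (simp_all add: qc_def)

lemma qc_linear: "qc c (q + r) = qc c q + qc c r" "qc c (s *\<^sub>R q) = s * qc c q"
  by (simp_all add: qc_def plus_quat_def scaleR_quat_def)

lemma quat_eq_qcI: "(\<And>c. c \<le> 3 \<Longrightarrow> qc c q = qc c r) \<Longrightarrow> q = r"
  unfolding quat_eq_iff using qc_simps(1)[of q] qc_simps(1)[of r] qc_simps(2)[of q] qc_simps(2)[of r]
    qc_simps(3)[of q] qc_simps(3)[of r] qc_simps(4)[of q] qc_simps(4)[of r] by force

definition base_quat :: "bool \<Rightarrow> quat" where
  "base_quat f = (if f then Quat 1 0 0 0 else Quat 0 1 0 0)"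

text \<open>The coordinates are grouped into blocks by \<open>blk\<close>, and \<open>pos\<close> names the quaternionic component that a
coordinate plays in its block. Every block has all imaginary components; it is three- or
four-dimensional according to whether it has a real one.\<close>

locale quaternionic_blocks =
  fixes blk pos :: "'n::finite \<Rightarrow> nat"
  assumes coords: "blk k = blk k' \<Longrightarrow> pos k = pos k' \<Longrightarrow> k = k'"
    and pos_le: "pos k \<le> 3"
    and imaginary: "c \<in> {1, 2, 3} \<Longrightarrow> \<exists>k'. blk k' = blk k \<and> pos k' = c"
begin

definition four :: "nat \<Rightarrow> bool" where
  "four \<beta> \<longleftrightarrow> (\<exists>k. blk k = \<beta> \<and> pos k = 0)"

definition entry :: "real ^ 'n \<Rightarrow> nat \<Rightarrow> nat \<Rightarrow> real" where
  "entry x \<beta> c = (\<Sum>k | blk k = \<beta> \<and> pos k = c. x $ k)"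

definition block :: "nat \<Rightarrow> real ^ 'n \<Rightarrow> quat" where
  "block \<beta> x = Quat (entry x \<beta> 0) (entry x \<beta> 1) (entry x \<beta> 2) (entry x \<beta> 3)"

definition block_act :: "(nat \<Rightarrow> quat) \<Rightarrow> real ^ 'n \<Rightarrow> real ^ 'n" where
  "block_act b x = (\<chi> k. qc (pos k) (act (four (blk k)) (b (blk k)) (block (blk k) x)) / qnorm (b (blk k)))"

lemma entry_coord: "entry x (blk k) (pos k) = x $ k"
proof -
  have "{j. blk j = blk k \<and> pos j = pos k} = {k}" using coords by blast
  then show ?thesis by (simp add: entry_def)
qed

lemma entry_empty: "(\<And>k. blk k = \<beta> \<Longrightarrow> pos k \<noteq> c) \<Longrightarrow> entry x \<beta> c = 0"
  unfolding entry_def by (rule sum.neutral) blast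

lemma qc_block: "c \<le> 3 \<Longrightarrow> qc c (block \<beta> x) = entry x \<beta> c"
proof -
  assume "c \<le> 3"
  then consider "c = 0" | "c = 1" | "c = 2" | "c = 3" by linarith
  then show ?thesis by cases (auto simp: qc_def block_def)
qed

lemma qc_pos_block: "qc (pos k) (block (blk k) x) = x $ k"
  by (simp add: qc_block pos_le entry_coord)

lemma block_pure: "\<not> four \<beta> \<Longrightarrow> qw (block \<beta> x) = 0"
  using entry_empty[of \<beta> 0 x] by (auto simp: four_def block_def)

lemma block_linear: "block \<beta> (x + y) = block \<beta> x + block \<beta> y" "block \<beta> (s *\<^sub>R x) = s *\<^sub>R block \<beta> x"
  by (simp_all add: block_def entry_def plus_quat_def scaleR_quat_def sum.distrib sum_distrib_left)

lemma blocks_eqI: "(\<And>k. block (blk k) x = block (blk k) y) \<Longrightarrow> x = y"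
  by (simp add: vec_eq_iff flip: qc_pos_block)

lemma block_eqI:
  assumes "\<And>k. blk k = \<beta> \<Longrightarrow> x $ k = qc (pos k) q" and "\<And>c. c \<le> 3 \<Longrightarrow> (\<And>k. blk k = \<beta> \<Longrightarrow> pos k \<noteq> c) \<Longrightarrow> qc c q = 0"
  shows "block \<beta> x = q"
proof (rule quat_eq_qcI)
  fix c :: nat assume c: "c \<le> 3"
  show "qc c (block \<beta> x) = qc c q"
  proof (cases "\<exists>k. blk k = \<beta> \<and> pos k = c")
    case True
    then obtain k where "blk k = \<beta>" "pos k = c" by blast
    then show ?thesis using assms(1)[of k] qc_pos_block[of k x] by simp
  next
    case False
    then have "entry x \<beta> c = 0" "qc c q = 0" using entry_empty[of \<beta> c x] assms(2)[OF c] by blast+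
    then show ?thesis by (simp add: qc_block c)
  qed
qed

lemma missing_entry:
  assumes "\<beta> \<in> range blk" "c \<le> 3" and no: "\<And>k. blk k = \<beta> \<Longrightarrow> pos k \<noteq> c"
  shows "c = 0 \<and> \<not> four \<beta>"
proof -
  obtain k where "\<beta> = blk k" using assms(1) by blast
  then have "c \<notin> {1, 2, 3}" using imaginary[of c k] no by blast
  then have "c = 0" using assms(2) by auto
  then show ?thesis using no unfolding four_def by blast
qed

lemma block_block_act:
  assumes "\<beta> \<in> range blk"
  shows "block \<beta> (block_act b x) = (1 / qnorm (b \<beta>)) *\<^sub>R act (four \<beta>) (b \<beta>) (block \<beta> x)"
proof (rule block_eqI)
  show "block_act b x $ k = qc (pos k) ((1 / qnorm (b \<beta>)) *\<^sub>R act (four \<beta>) (b \<beta>) (block \<beta> x))"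
    if "blk k = \<beta>" for k
    using that by (auto simp: block_act_def qc_linear)
next
  fix c :: nat assume c: "c \<le> 3" and no: "\<And>k. blk k = \<beta> \<Longrightarrow> pos k \<noteq> c"
  from missing_entry[OF assms c no] show "qc c ((1 / qnorm (b \<beta>)) *\<^sub>R act (four \<beta>) (b \<beta>) (block \<beta> x)) = 0"
    using act_pure[OF block_pure] by (simp add: qc_linear qc_simps)
qed

lemma norm_blocks: "(norm x)\<^sup>2 = (\<Sum>\<beta>\<in>range blk. qnorm (block \<beta> x))"
proof -
  have sq: "(\<Sum>k | blk k = \<beta> \<and> pos k = c. (x $ k)\<^sup>2) = (entry x \<beta> c)\<^sup>2" for \<beta> c
  proof (cases "\<exists>k. blk k = \<beta> \<and> pos k = c")
    case True
    then obtain k where k: "blk k = \<beta>" "pos k = c" by blast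
    then have "{j. blk j = \<beta> \<and> pos j = c} = {k}" using coords by blast
    then show ?thesis by (simp add: entry_def)
  next
    case False
    then have "{j. blk j = \<beta> \<and> pos j = c} = {}" by blast
    then show ?thesis by (simp only: entry_def sum.empty) simp
  qed
  have "(norm x)\<^sup>2 = (\<Sum>k\<in>UNIV. (x $ k)\<^sup>2)" by (simp add: norm_vec_def L2_set_def sum_nonneg)
  also have "\<dots> = (\<Sum>\<beta>\<in>range blk. \<Sum>k | k \<in> UNIV \<and> blk k = \<beta>. (x $ k)\<^sup>2)"
    by (rule sum.image_gen) simp
  also have "\<dots> = (\<Sum>\<beta>\<in>range blk. qnorm (block \<beta> x))"
  proof (rule sum.cong[OF refl])
    fix \<beta>
    have "pos ` {k. blk k = \<beta>} \<subseteq> {0,1,2,3}"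
    proof (rule image_subsetI)
      fix k show "pos k \<in> {0,1,2,3}" using pos_le[of k] by auto
    qed
    from sum.group[OF _ _ this, of "\<lambda>k. (x $ k)\<^sup>2"]
    have "(\<Sum>c\<in>{0,1,2,3}. \<Sum>k | k \<in> {k. blk k = \<beta>} \<and> pos k = c. (x $ k)\<^sup>2) = (\<Sum>k | blk k = \<beta>. (x $ k)\<^sup>2)"
      by simp
    then show "(\<Sum>k | k \<in> UNIV \<and> blk k = \<beta>. (x $ k)\<^sup>2) = qnorm (block \<beta> x)"
      by (simp add: sq qnorm_def block_def)
  qed
  finally show ?thesis .
qed

lemma norm_block_act:
  assumes "\<And>\<beta>. \<beta> \<in> range blk \<Longrightarrow> qnorm (b \<beta>) \<noteq> 0"
  shows "norm (block_act b x) = norm x"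
proof -
  have "(norm (block_act b x))\<^sup>2 = (norm x)\<^sup>2"
    unfolding norm_blocks using assms
    by (intro sum.cong) (auto simp: block_block_act qnorm_scale qnorm_act power_divide)
  then show ?thesis by (simp add: power2_eq_iff_nonneg)
qed

lemma linear_block_act: "linear (block_act b)"
  by (rule linearI)
    (simp_all add: block_act_def vec_eq_iff block_linear act_add act_scale qc_linear add_divide_distrib)

lemma block_act_inverse:
  assumes "\<And>\<beta>. \<beta> \<in> range blk \<Longrightarrow> qnorm (b \<beta>) \<noteq> 0"
  shows "block_act (\<lambda>\<beta>. qconj (b \<beta>)) (block_act b x) = x"
  by (rule blocks_eqI)
    (use assms in \<open>simp add: block_block_act act_scale act_conj power2_eq_square\<close>)

text \<open>Its direction is that of the translation vector: the unit \<open>1\<close> in four-dimensional blocks and the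
unit \<open>i\<close> in three-dimensional ones. No block may vanish, since the images of the vector under the
letters have to point in all directions.\<close>

definition base_point :: "real ^ 'n" where
  "base_point = (\<chi> k. if pos k = (if four (blk k) then 0 else 1) then 1 else 0)"

lemma block_base_point: "\<beta> \<in> range blk \<Longrightarrow> block \<beta> base_point = base_quat (four \<beta>)"
proof (rule block_eqI)
  fix c :: nat assume \<beta>: "\<beta> \<in> range blk" and c: "c \<le> 3" and no: "\<And>k. blk k = \<beta> \<Longrightarrow> pos k \<noteq> c"
  from missing_entry[OF \<beta> c no] show "qc c (base_quat (four \<beta>)) = 0" by (simp add: base_quat_def qc_def)
qed (auto simp: base_point_def base_quat_def qc_def)

end

text \<open>The letters of these quaternions move \<open>1\<close> to all signed units \<open>1, i, j, k\<close>, and \<open>i\<close> to all signed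
imaginary units.\<close>

definition targets :: "quat set" where
  "targets = {Quat 1 0 0 0, Quat 0 1 0 0, Quat 0 0 1 0, Quat 1 1 0 0, Quat 1 (-1) 0 0, Quat 1 0 1 0, Quat 1 0 (-1) 0,
     Quat 1 0 0 1, Quat 1 0 0 (-1)}"

lemma target_exists:
  assumes "c \<le> 3" "\<not> f \<Longrightarrow> c \<noteq> 0"  "s = 1 \<or> s = - 1"
  shows "\<exists>T\<in>targets. \<forall>c'\<le>3. qc c' (act f T (base_quat f)) / qnorm T = (if c' = c then s else 0)"
proof -
  define U where "U = (if c = 0 then Quat s 0 0 0 else if c = 1 then Quat 0 s 0 0 else if c = 2 then Quat 0 0 s 0 else Quat 0 0 0 s)"
  note defs = base_quat_def targets_def U_def act_def qnorm_def qconj_def times_quat_def scaleR_quat_def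
  have c: "c = 0 \<or> c = 1 \<or> c = 2 \<or> c = 3" using assms(1) by linarith
  have "\<exists>T\<in>targets. qnorm T \<noteq> 0 \<and> act f T (base_quat f) = qnorm T *\<^sub>R U"
  proof (cases f)
    case True
    define T where "T = (if c = 0 then (if s = 1 then Quat 1 0 0 0 else Quat 0 1 0 0)
       else if c = 1 then Quat 1 s 0 0 else if c = 2 then Quat 1 0 s 0 else Quat 1 0 0 s)"
    show ?thesis using c assms(3) True by (intro bexI[of _ T]) (elim disjE; simp add: T_def defs)+
  next
    case False
    define T where "T = (if c = 1 then (if s = 1 then Quat 1 0 0 0 else Quat 0 0 1 0)
       else if c = 2 then Quat 1 0 0 s else Quat 1 0 (- s) 0)"
    show ?thesis using c assms(2,3) False by (intro bexI[of _ T]) (elim disjE; simp add: T_def defs)+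
  qed
  then obtain T where T: "T \<in> targets" "qnorm T \<noteq> 0"
    "act f T (base_quat f) = qnorm T *\<^sub>R U" by blast
  have "qc c' U = (if c' = c then s else 0)" if "c' \<le> 3" for c'
    using that assms(1) by (simp add: U_def qc_def)
  with T show ?thesis by (intro bexI[of _ T]) (auto simp: qc_linear)
qed

lemma quat_deform:
  "\<exists>X Y. \<forall>t. act f (T + t *\<^sub>R a) y = act f T y + t *\<^sub>R X + t\<^sup>2 *\<^sub>R Y"
proof (cases f)
  case True
  then show ?thesis
    by (intro exI[of _ "(T * a + a * T) * y"] exI[of _ "a * a * y"])
      (simp add: act_def algebra_simps power2_eq_square)
next
  case False
  then show ?thesis
    by (intro exI[of _ "T * y * qconj a + a * y * qconj T"] exI[of _ "a * y * qconj a"])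
      (simp add: act_def qconj_add qconj_scale algebra_simps power2_eq_square)
qed

lemma qnorm_deform: "qnorm (T + t *\<^sub>R a) = qnorm T + t * (2 * qw (T * qconj a)) + t\<^sup>2 * qnorm a"
  by (simp add: qnorm_def qconj_def plus_quat_def times_quat_def scaleR_quat_def power2_eq_square algebra_simps)

context quaternionic_blocks begin

lemma block_act_scale_left:
  assumes "c \<noteq> 0" shows "block_act (\<lambda>\<beta>. c *\<^sub>R b \<beta>) x = block_act b x"
  using assms by (simp add: block_act_def act_scale_left qnorm_scale qc_linear vec_eq_iff)

text \<open>Letters depend on their quaternion only up to a real factor, so a quaternion that has a huge
multiple of \<open>T\<close> added to it acts almost like \<open>T\<close>.\<close>

lemma block_act_tendsto:
  assumes T: "\<And>\<beta>. \<beta> \<in> range blk \<Longrightarrow> qnorm (T \<beta>) \<noteq> 0" and s: "filterlim s at_top F"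
  shows "((\<lambda>j. block_act (\<lambda>\<beta>. a \<beta> + s j *\<^sub>R T \<beta>) x) \<longlongrightarrow> block_act T x) F"
proof -
  define t where "t j = inverse (s j)" for j
  have t: "(t \<longlongrightarrow> 0) F" unfolding t_def
    using filterlim_compose[OF tendsto_inverse_0 filterlim_mono[OF s at_top_le_at_infinity order_refl]] .
  have "((\<lambda>j. block_act (\<lambda>\<beta>. T \<beta> + t j *\<^sub>R a \<beta>) x) \<longlongrightarrow> block_act T x) F"
  proof (rule vec_tendstoI)
    fix k
    let ?f = "four (blk k)" and ?T = "T (blk k)" and ?a = "a (blk k)" and ?y = "block (blk k) x"
    obtain X Y where XY: "\<And>r. act ?f (?T + r *\<^sub>R ?a) ?y = act ?f ?T ?y + r *\<^sub>R X + r\<^sup>2 *\<^sub>R Y"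
      using quat_deform[of ?f ?T ?a ?y] by blast
    have "((\<lambda>j. (qc (pos k) (act ?f ?T ?y) + t j * qc (pos k) X + (t j)\<^sup>2 * qc (pos k) Y) /
        (qnorm ?T + t j * (2 * qw (?T * qconj ?a)) + (t j)\<^sup>2 * qnorm ?a)) \<longlongrightarrow>
        (qc (pos k) (act ?f ?T ?y) + 0 * qc (pos k) X + 0\<^sup>2 * qc (pos k) Y) /
        (qnorm ?T + 0 * (2 * qw (?T * qconj ?a)) + 0\<^sup>2 * qnorm ?a)) F"
      using T by (intro tendsto_intros t) auto
    then show "((\<lambda>j. block_act (\<lambda>\<beta>. T \<beta> + t j *\<^sub>R a \<beta>) x $ k) \<longlongrightarrow> block_act T x $ k) F"
      by (simp add: block_act_def XY qc_linear qnorm_deform)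
  qed
  moreover have "\<forall>\<^sub>F j in F. s j > 0" using s by (simp add: filterlim_at_top_dense)
  then have "\<forall>\<^sub>F j in F. block_act (\<lambda>\<beta>. T \<beta> + t j *\<^sub>R a \<beta>) x = block_act (\<lambda>\<beta>. a \<beta> + s j *\<^sub>R T \<beta>) x"
  proof (rule eventually_mono)
    fix j assume "s j > 0"
    then have "a \<beta> + s j *\<^sub>R T \<beta> = s j *\<^sub>R (T \<beta> + t j *\<^sub>R a \<beta>)" for \<beta>
      by (simp add: t_def scaleR_add_right)
    then show "block_act (\<lambda>\<beta>. T \<beta> + t j *\<^sub>R a \<beta>) x = block_act (\<lambda>\<beta>. a \<beta> + s j *\<^sub>R T \<beta>) x"
      using block_act_scale_left[of "s j"] \<open>s j > 0\<close> by simp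
  qed
  ultimately show ?thesis by (rule Lim_transform_eventually)
qed

text \<open>Choose one coordinate in each block, in the block of the largest coordinate of \<open>x\<close> that one, and
send the base point to the corresponding units with signs opposite to those of \<open>x\<close>. No block then
contributes positively to the inner product.\<close>

lemma target_direction:
  fixes x :: "real ^ 'n"
  shows "\<exists>T. T ` range blk \<subseteq> targets \<and> x \<bullet> block_act T base_point \<le> - (norm x / real CARD('n))"
proof -
  define M where "M = Max (range (\<lambda>k. \<bar>x $ k\<bar>))"
  have M: "\<bar>x $ k\<bar> \<le> M" for k unfolding M_def by (intro Max_ge) auto
  have "M \<in> range (\<lambda>k. \<bar>x $ k\<bar>)" unfolding M_def by (intro Max_in) auto
  then obtain h where h: "\<bar>x $ h\<bar> = M" by auto
  define \<kappa> where "\<kappa> \<beta> = (if \<beta> = blk h then h else SOME k. blk k = \<beta>)" for \<beta>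
  have \<kappa>: "blk (\<kappa> (blk k)) = blk k" for k
    unfolding \<kappa>_def by (auto intro: someI[of "\<lambda>j. blk j = blk k" k])
  have \<kappa>h: "\<kappa> (blk h) = h" by (simp add: \<kappa>_def)
  define s where "s \<beta> = (if x $ \<kappa> \<beta> \<ge> 0 then - 1 else 1 :: real)" for \<beta>
  have "\<exists>T\<in>targets. \<forall>c'\<le>3. qc c' (act (four (blk k)) T (base_quat (four (blk k)))) / qnorm T =
      (if c' = pos (\<kappa> (blk k)) then s (blk k) else 0)" for k
    by (rule target_exists) (use pos_le \<kappa> in \<open>auto simp: s_def four_def\<close>)
  then have "\<forall>\<beta>\<in>range blk. \<exists>T. T \<in> targets \<and> (\<forall>c'\<le>3. qc c' (act (four \<beta>) T (base_quat (four \<beta>))) / qnorm T =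
      (if c' = pos (\<kappa> \<beta>) then s \<beta> else 0))" by blast
  then obtain T where T: "\<And>\<beta>. \<beta> \<in> range blk \<Longrightarrow> T \<beta> \<in> targets"
    "\<And>\<beta> c'. \<beta> \<in> range blk \<Longrightarrow> c' \<le> 3 \<Longrightarrow> qc c' (act (four \<beta>) (T \<beta>) (base_quat (four \<beta>))) / qnorm (T \<beta>) =
      (if c' = pos (\<kappa> \<beta>) then s \<beta> else 0)"
    by (metis bchoice)
  have coord: "block_act T base_point $ k = (if k = \<kappa> (blk k) then s (blk k) else 0)" for k
  proof -
    have "pos k = pos (\<kappa> (blk k)) \<longleftrightarrow> k = \<kappa> (blk k)" using coords[of k "\<kappa> (blk k)"] \<kappa> by metis
    then show ?thesis using T(2)[of "blk k" "pos k"] pos_le by (simp add: block_act_def block_base_point)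
  qed
  have "x \<bullet> block_act T base_point = (\<Sum>k\<in>UNIV. x $ k * (if k = \<kappa> (blk k) then s (blk k) else 0))"
    by (simp add: inner_vec_def coord)
  also have "\<dots> \<le> (\<Sum>k\<in>UNIV. if k = h then - M else 0)"
  proof (rule sum_mono)
    fix k
    have "x $ k * s (blk k) = - \<bar>x $ k\<bar>" if "k = \<kappa> (blk k)" using that by (simp add: s_def)
    then show "x $ k * (if k = \<kappa> (blk k) then s (blk k) else 0) \<le> (if k = h then - M else 0)"
      using h \<kappa>h by auto
  qed
  also have "\<dots> = - M" by simp
  also have "\<dots> \<le> - (norm x / real CARD('n))"
  proof -
    have "norm x \<le> (\<Sum>k\<in>UNIV. \<bar>x $ k\<bar>)" by (rule norm_le_l1_cart)
    also have "\<dots> \<le> (\<Sum>k\<in>(UNIV :: 'n set). M)" by (intro sum_mono M)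
    finally show ?thesis by (simp add: field_simps)
  qed
  finally show ?thesis using T(1) by blast
qed

end

section \<open>Letters with exact norm\<close>

context prime_place begin

lemma integral_imp_rational: "integral_at r \<Longrightarrow> r \<in> \<rat>"
  unfolding integral_at_def by auto

lemma integral_inverse:
  assumes "integral_at r" "\<not> divisible_at r" shows "integral_at (inverse r)"
proof -
  from assms(1) obtain a b :: int where r: "\<not> int p dvd b" "r = of_int a / of_int b"
    unfolding integral_at_def by blast
  have "\<not> int p dvd a"
  proof
    assume "int p dvd a"
    then have "divisible_at (of_int a * (of_int 1 / of_int b))"
      using r(1) by (intro divisible_mult(1)) (auto simp only: divisible_of_int integral_at_def)
    with assms(2) r show False by simp
  qed
  with r show ?thesis unfolding integral_at_def by (intro exI[of _ b] exI[of _ a]) simp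
qed

lemma divisible_sum: "(\<And>i. i \<in> A \<Longrightarrow> divisible_at (f i)) \<Longrightarrow> divisible_at (sum f A)"
  by (induction A rule: infinite_finite_induct) (auto intro: divisible_add)

lemma not_divisible_small:
  fixes k :: int assumes "k \<noteq> 0" "\<bar>k\<bar> < int p" shows "\<not> divisible_at (of_int k)"
  using assms zdvd_imp_le[of "int p" "\<bar>k\<bar>"] by (auto simp: divisible_of_int)

end

locale adic_blocks = quaternionic_blocks blk pos + prime_place p
  for blk pos :: "'n::finite \<Rightarrow> nat" and p :: nat
begin

lemma integral_vec_blocks: "integral_vec x \<longleftrightarrow> (\<forall>k. integral_quat (block (blk k) x))"
proof
  assume "integral_vec x"
  then have "integral_at (entry x \<beta> c)" for \<beta> c
    unfolding entry_def integral_vec_def by (intro integral_sum) blast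
  then show "\<forall>k. integral_quat (block (blk k) x)" by (simp add: integral_quat_def block_def)
next
  assume *: "\<forall>k. integral_quat (block (blk k) x)"
  have "integral_at (qc c q)" if "integral_quat q" for c q
    using that by (simp add: integral_quat_def qc_def)
  then show "integral_vec x" using * unfolding integral_vec_def by (metis qc_pos_block)
qed

lemma divisible_vec_blocks: "divisible_vec x \<longleftrightarrow> (\<forall>k. divisible_quat (block (blk k) x))"
proof
  assume "divisible_vec x"
  then have "divisible_at (entry x \<beta> c)" for \<beta> c
    unfolding entry_def divisible_vec_def by (intro divisible_sum) blast
  then show "\<forall>k. divisible_quat (block (blk k) x)" by (simp add: divisible_quat_def block_def)
next
  assume *: "\<forall>k. divisible_quat (block (blk k) x)"
  have "divisible_at (qc c q)" if "divisible_quat q" for c q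
    using that by (simp add: divisible_quat_def qc_def)
  then show "divisible_vec x" using * unfolding divisible_vec_def by (metis qc_pos_block)
qed

text \<open>In all blocks the norms contain exactly the \<open>e\<close>-th power of \<open>p\<close>. The exponents must agree between the
blocks, because the valuation of a vector is the minimum over the blocks.\<close>

definition exact_letter :: "nat \<Rightarrow> (nat \<Rightarrow> quat) \<Rightarrow> bool" where
  "exact_letter e b \<longleftrightarrow> (\<forall>\<beta>\<in>range blk. integral_quat (b \<beta>) \<and>
     integral_at (qnorm (b \<beta>) / real p ^ e) \<and> \<not> divisible_at (qnorm (b \<beta>) / real p ^ e))"

lemma exact_letter_conj: "exact_letter e b \<Longrightarrow> exact_letter e (\<lambda>\<beta>. qconj (b \<beta>))"
  by (auto simp: exact_letter_def integral_quat_simps)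

lemma exact_letter_unit:
  assumes "exact_letter e b" "\<beta> \<in> range blk"
  shows "qnorm (b \<beta>) \<noteq> 0" "integral_at (real p ^ e / qnorm (b \<beta>))"
    "\<not> divisible_at (real p ^ e / qnorm (b \<beta>))" "e > 0 \<Longrightarrow> divisible_at (qnorm (b \<beta>))"
proof -
  define r where "r = qnorm (b \<beta>) / real p ^ e"
  have r: "integral_at r" "\<not> divisible_at r" using assms by (auto simp: exact_letter_def r_def)
  then have "r \<noteq> 0" by auto
  then show "qnorm (b \<beta>) \<noteq> 0" by (simp add: r_def)
  have inv: "real p ^ e / qnorm (b \<beta>) = inverse r" by (simp add: r_def)
  then show "integral_at (real p ^ e / qnorm (b \<beta>))" using integral_inverse[OF r] by simp
  show "\<not> divisible_at (real p ^ e / qnorm (b \<beta>))"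
  proof
    assume "divisible_at (real p ^ e / qnorm (b \<beta>))"
    then have "divisible_at (inverse r * r)" using inv r by (intro divisible_mult(1)) auto
    then have "int p dvd 1" using \<open>r \<noteq> 0\<close> divisible_of_int[of 1] by simp
    then show False using prime_int not_prime_unit by blast
  qed
  show "divisible_at (qnorm (b \<beta>))" if "e > 0"
  proof -
    obtain k where "e = Suc k" using \<open>e > 0\<close> by (cases e) auto
    then have "qnorm (b \<beta>) = of_int (int p) * (real p ^ k * r)" using p_pos by (simp add: r_def)
    moreover have "integral_at (real p ^ k * r)" using r by (intro integral_intros) auto
    ultimately show ?thesis using divisible_mult(1)[of "of_int (int p)"] divisible_of_int[of "int p"] by simp
  qed
qed

lemma block_scaled_letter:
  assumes "\<beta> \<in> range blk"
  shows "block \<beta> (real p ^ e *\<^sub>R block_act b x) =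
    (real p ^ e / qnorm (b \<beta>)) *\<^sub>R act (four \<beta>) (b \<beta>) (block \<beta> x)"
  by (simp add: block_linear block_block_act assms)

lemma letter_integral:
  assumes "exact_letter e b" "integral_vec x"
  shows "integral_vec (real p ^ e *\<^sub>R block_act b x)"
  unfolding integral_vec_blocks
proof
  fix k
  have "integral_quat (act (four (blk k)) (b (blk k)) (block (blk k) x))"
    using assms unfolding integral_vec_blocks exact_letter_def by (intro integral_act) auto
  then show "integral_quat (block (blk k) (real p ^ e *\<^sub>R block_act b x))"
    using exact_letter_unit(2)[OF assms(1), of "blk k"]
    by (subst block_scaled_letter) (auto intro: integral_quat_simps(5))
qed

lemma letter_divisible_iff:
  assumes "exact_letter e b" "integral_vec x"
  shows "divisible_vec (real p ^ e *\<^sub>R block_act b x) \<longleftrightarrow>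
    (\<forall>k. divisible_quat (act (four (blk k)) (b (blk k)) (block (blk k) x)))"
proof -
  have "divisible_quat (block \<beta> (real p ^ e *\<^sub>R block_act b x)) \<longleftrightarrow>
      divisible_quat (act (four \<beta>) (b \<beta>) (block \<beta> x))" if "\<beta> \<in> range blk" for \<beta>
  proof -
    have "integral_quat (act (four \<beta>) (b \<beta>) (block \<beta> x))"
      using assms that unfolding integral_vec_blocks exact_letter_def by (auto intro: integral_act)
    then show ?thesis
      using divisible_quat_scale_cancel exact_letter_unit(2,3)[OF assms(1) that] divisible_quat_ideal(6)
      unfolding block_scaled_letter[OF that] by blast
  qed
  then show ?thesis unfolding divisible_vec_blocks by blast
qed

lemma letter_rational:
  assumes "exact_letter e b" shows "rational_map (block_act b)"
proof -
  have "integral_vec (real p ^ e *\<^sub>R block_act b (axis l 1))" for l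
    by (rule letter_integral[OF assms]) (auto simp: integral_vec_def axis_def)
  then have "inverse (real p ^ e) * (real p ^ e * block_act b (axis l 1) $ k) \<in> \<rat>" for l k
    by (intro Rats_mult Rats_inverse Rats_power integral_imp_rational) (auto simp: integral_vec_def)
  moreover have "inverse (real p ^ e) * (real p ^ e * r) = r" for r using p_pos by (simp add: field_simps)
  ultimately have "block_act b (axis l 1) $ k \<in> \<rat>" for l k by simp
  then show ?thesis using linear_block_act by (simp add: rational_map_def rational_vec_def)
qed

text \<open>The parameters of the \<open>2 n\<close> lines that serve as images and kernels of the letters; they are distinct
and nonzero modulo a prime larger than \<open>2 n + 2\<close>.\<close>

definition slot :: "bool \<Rightarrow> nat \<Rightarrow> real" where
  "slot s i = of_int (2 * int i + (if s then 2 else 1))"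

lemma slot_integral [simp]: "integral_at (slot s i)"
  unfolding slot_def by (rule integral_of_int)

lemma slot_distinct:
  assumes "2 * n + 2 < p" "i < n" "j < n" "(s, i) \<noteq> (t, j)"
  shows "\<not> divisible_at (slot s i - slot t j)"
proof -
  define k where "k = (2 * int i + (if s then 2 else 1)) - (2 * int j + (if t then 2 else 1))"
  have "k \<noteq> 0" using assms(4) unfolding k_def by (cases s; cases t) (auto, presburger+)
  moreover have "\<bar>k\<bar> < int p" using assms(1-3) by (auto simp: k_def)
  moreover have "slot s i - slot t j = of_int k" by (simp add: slot_def k_def)
  ultimately show ?thesis using not_divisible_small by simp
qed

lemma slot_not_divisible:
  assumes "2 * n + 2 < p" "i < n" shows "\<not> divisible_at (slot s i)"
  unfolding slot_def using assms by (intro not_divisible_small) auto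

definition letter :: "(nat \<Rightarrow> nat \<Rightarrow> quat) \<Rightarrow> bool \<Rightarrow> nat \<Rightarrow> nat \<Rightarrow> quat" where
  "letter b s i \<beta> = (if s then b i \<beta> else qconj (b i \<beta>))"

lemma letter_conj: "letter b (\<not> s) i = (\<lambda>\<beta>. qconj (letter b s i \<beta>))"
  by (auto simp: letter_def)

text \<open>All \<open>p\<close>-adic conditions are inherited from a single block: an integral vector is nonzero modulo \<open>p\<close> if
one of its blocks is. The vector \<open>u\<close> is expanded by all letters since the unit \<open>1\<close> is mapped to
the square of a quaternion of nonzero trace, and since the form of the unit \<open>i\<close> is \<open>2 \<iota> l\<close>, which
is nonzero at every slot.\<close>

lemma expanding_isometries_blocks:
  assumes \<iota>: "integral_at \<iota>" "divisible_at (\<iota>\<^sup>2 + 1)" and p: "odd p" "2 * n + 2 < p"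
    and ends: "\<And>i \<beta>. i < n \<Longrightarrow> \<beta> \<in> range blk \<Longrightarrow> has_ends \<iota> (slot False i) (slot True i) (b i \<beta>)"
    and exact: "\<And>i. i < n \<Longrightarrow> exact_letter (Suc i) (b i)"
    and u: "u = real p powi (- \<kappa>) *\<^sub>R base_point" and u_small: "norm u < 1 / 2"
    and room: "\<And>x. 1 / 2 \<le> norm x \<Longrightarrow> norm x \<le> 1 \<Longrightarrow>
      card {i. i < n \<and> norm (block_act (letter b False i) x + u) \<le> norm x} \<ge> 4"
  shows "expanding_isometries p n Suc (\<lambda>s i. block_act (letter b s i)) u"
proof -
  have ends: "has_ends \<iota> (slot (\<not> s) i) (slot s i) (letter b s i \<beta>)" if "i < n" "\<beta> \<in> range blk" for s i \<beta>
    using ends[OF that] has_ends_conj by (auto simp: letter_def)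
  have exact: "exact_letter (Suc i) (letter b s i)" if "i < n" for s i
    using exact[OF that] exact_letter_conj[of "Suc i" "b i"] by (cases s) (auto simp: letter_def[abs_def])
  have int: "integral_quat (letter b s i \<beta>)" if "i < n" "\<beta> \<in> range blk" for s i \<beta>
    using exact[OF that(1)] that(2) unfolding exact_letter_def by blast
  have dn: "divisible_at (qnorm (letter b s i \<beta>))" if "i < n" "\<beta> \<in> range blk" for s i \<beta>
    using exact_letter_unit(4)[OF exact[OF that(1)] that(2)] by simp
  have nz: "qnorm (letter b s i \<beta>) \<noteq> 0" if "i < n" "\<beta> \<in> range blk" for s i \<beta>
    using exact_letter_unit(1)[OF exact[OF that(1)] that(2)] .
  have qw: "\<not> divisible_at (qw (letter b s i \<beta>))" if "i < n" "\<beta> \<in> range blk" for s i \<beta>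
    by (rule qw_not_divisible[OF \<iota> p(1) _ _ ends[OF that]]) (use slot_distinct[OF p(2)] that in auto)
  have qw2: "\<not> divisible_at (qw (letter b t j \<beta> * letter b s i \<beta>))"
    if "i < n" "j < n" "\<beta> \<in> range blk" "(t, j) \<noteq> (\<not> s, i)" for s t i j \<beta>
    by (rule qw_mult_divisible[OF \<iota> p(1) _ _ _ _ ends[OF that(2,3)] ends[OF that(1,3)]])
      (use slot_distinct[OF p(2)] that in auto)
  have base_integral: "integral_vec base_point" by (simp add: integral_vec_def base_point_def)
  have base_not: "\<not> divisible_vec base_point"
  proof -
    have "\<not> divisible_at 1" using divisible_of_int[of 1] prime_int not_prime_unit by auto
    moreover have "\<exists>k. base_point $ k = (1 :: real)"
    proof (cases "\<exists>k. pos k = 0")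
      case True
      then obtain k where "pos k = 0" by blast
      then have "base_point $ k = 1" by (auto simp: base_point_def four_def)
      then show ?thesis ..
    next
      case False
      fix k0 :: 'n
      obtain k where "pos k = 1" using imaginary[of 1 k0] by auto
      with False have "base_point $ k = 1" by (auto simp: base_point_def four_def)
      then show ?thesis ..
    qed
    ultimately show ?thesis unfolding divisible_vec_def by metis
  qed
  have base_val: "has_val 0 base_point"
    using base_integral base_not by (simp add: has_val_def val_ge_0 val_ge_1)
  have u_val: "has_val (- \<kappa>) u" using base_val by (simp add: u has_val_scale)
  show ?thesis
  proof (unfold_locales)
    show "rational_map (block_act (letter b s i))" if "i < n" for s i
      using letter_rational[OF exact[OF that]] .
    show "norm (block_act (letter b s i) x) = norm x" if "i < n" for s i x
      using norm_block_act nz[OF that] by blast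
    show "block_act (letter b (\<not> s) i) (block_act (letter b s i) x) = x" if "i < n" for s i x
      unfolding letter_conj using block_act_inverse nz[OF that] by blast
    show "integral_vec (real p ^ Suc i *\<^sub>R block_act (letter b s i) z)" if "i < n" "integral_vec z" for s i z
      using letter_integral[OF exact[OF that(1)] that(2)] .
    show "\<not> divisible_vec (real p ^ Suc j *\<^sub>R block_act (letter b t j) (real p ^ Suc i *\<^sub>R block_act (letter b s i) z))"
      if h: "i < n" "j < n" "(t, j) \<noteq> (\<not> s, i)" "integral_vec z"
        "\<not> divisible_vec (real p ^ Suc i *\<^sub>R block_act (letter b s i) z)" for s t i j z
    proof -
      let ?z = "real p ^ Suc i *\<^sub>R block_act (letter b s i) z"
      from h(5) obtain k where k: "\<not> divisible_quat (act (four (blk k)) (letter b s i (blk k)) (block (blk k) z))"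
        using letter_divisible_iff[OF exact[OF h(1)] h(4)] by blast
      let ?\<beta> = "blk k"
      have "\<not> divisible_quat (act (four ?\<beta>) (letter b t j ?\<beta>) (act (four ?\<beta>) (letter b s i ?\<beta>) (block ?\<beta> z)))"
        using h k by (intro act_keeps_expanding p int dn qw qw2) (auto simp: integral_vec_blocks)
      moreover have "integral_quat (act (four ?\<beta>) (letter b t j ?\<beta>) (act (four ?\<beta>) (letter b s i ?\<beta>) (block ?\<beta> z)))"
        using h by (intro integral_act int) (auto simp: integral_vec_blocks)
      ultimately have "\<not> divisible_quat (act (four ?\<beta>) (letter b t j ?\<beta>) (block ?\<beta> ?z))"
        using exact_letter_unit(2,3)[OF exact[OF h(1)], of ?\<beta> s] divisible_quat_scale_cancel
        by (subst block_scaled_letter) (auto simp: act_scale)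
      then show ?thesis
        using letter_divisible_iff[OF exact[OF h(2)] letter_integral[OF exact[OF h(1)] h(4)]] by blast
    qed
    show "card {i. i < n \<and> divisible_vec (real p ^ Suc i *\<^sub>R block_act (letter b False i) z)} \<le> 2"
      if z: "integral_vec z" "\<not> divisible_vec z" for z
    proof (rule ccontr)
      let ?S = "{i. i < n \<and> divisible_vec (real p ^ Suc i *\<^sub>R block_act (letter b False i) z)}"
      assume "\<not> card ?S \<le> 2"
      then have "3 \<le> card ?S" by simp
      then obtain S where "S \<subseteq> ?S" "card S = 3" by (rule obtain_subset_with_card_n)
      then obtain i1 i2 i3 where i: "{i1, i2, i3} \<subseteq> ?S" "i1 \<noteq> i2" "i1 \<noteq> i3" "i2 \<noteq> i3"
        by (auto simp: card_3_iff)
      from z obtain k where k: "\<not> divisible_quat (block (blk k) z)" by (auto simp: divisible_vec_blocks)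
      let ?\<beta> = "blk k" and ?x = "block (blk k) z"
      have x: "integral_quat ?x" using z by (auto simp: integral_vec_blocks)
      have d: "i < n" "divisible_quat (act (four ?\<beta>) (qconj (b i ?\<beta>)) ?x)" if "i \<in> ?S" for i
        using that letter_divisible_iff[OF exact z(1), of i False] by (auto simp: letter_def)
      note ends' = ends[of _ ?\<beta> True, unfolded letter_def, simplified]
      have n: "i1 < n" "i2 < n" "i3 < n" and dd: "divisible_quat (act (four ?\<beta>) (qconj (b i1 ?\<beta>)) ?x)"
        "divisible_quat (act (four ?\<beta>) (qconj (b i2 ?\<beta>)) ?x)" "divisible_quat (act (four ?\<beta>) (qconj (b i3 ?\<beta>)) ?x)"
        using d[OF subsetD[OF i(1)], of i1] d[OF subsetD[OF i(1)], of i2] d[OF subsetD[OF i(1)], of i3]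
        by simp_all
      show False
      proof (cases "four ?\<beta>")
        case True
        have \<beta>: "?\<beta> \<in> range blk" by simp
        have pos: "integral_quat (b i ?\<beta>)" "divisible_at (qnorm (b i ?\<beta>))" "\<not> divisible_at (qw (b i ?\<beta>))"
          if "i < n" for i
          using int[OF that \<beta>, of True] dn[OF that \<beta>, of True] qw[OF that \<beta>, of True]
          by (simp_all add: letter_def)
        have "\<not> divisible_at (qw (b i1 ?\<beta> * qconj (b i2 ?\<beta>)))"
          using qw2[OF n(2,1) \<beta>, of True False] i(2) by (simp add: letter_def)
        from contract_four_unique[OF p(1) pos(1)[OF n(1)] pos(1)[OF n(2)] x pos(2)[OF n(1)] pos(2)[OF n(2)] this
            pos(3)[OF n(1)] pos(3)[OF n(2)]] dd(1,2) True
        have "divisible_quat ?x" by simp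
        with k show False by simp
      next
        case False
        have f: "divisible_at (end_form \<iota> ?x (slot False i))"
          if "i < n" "divisible_quat (act (four ?\<beta>) (qconj (b i ?\<beta>)) ?x)" for i
          using contract_three_end_form[OF \<iota> p(1) slot_integral slot_integral ends'[OF that(1)] x block_pure[OF False]]
            that(2) False by simp
        have "divisible_quat ?x"
          by (rule end_form_three_roots[OF \<iota> p(1) x block_pure[OF False] slot_integral slot_integral slot_integral
                slot_distinct[OF p(2) n(1,2)] slot_distinct[OF p(2) n(1,3)] slot_distinct[OF p(2) n(2,3)]
                f[OF n(1) dd(1)] f[OF n(2) dd(2)] f[OF n(3) dd(3)]]) (use i in auto)
        with k show False by simp
      qed
    qed
    have "rational_vec base_point" by (auto simp: rational_vec_def base_point_def)
    moreover have "real p powi (- \<kappa>) \<in> \<rat>" unfolding power_int_def by auto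
    ultimately show "rational_vec u" unfolding u rational_vec_def by (auto intro!: Rats_mult)
    show "u \<noteq> 0" using has_val_nonzero[OF u_val] .
    show "expands (Suc i) (block_act (letter b s i)) u" if "i < n" for s i
    proof -
      fix k :: 'n
      let ?\<beta> = "blk k" and ?q = "letter b s i (blk k)"
      have "\<not> divisible_quat (act (four ?\<beta>) ?q (base_quat (four ?\<beta>)))"
      proof (cases "four ?\<beta>")
        case True
        have "Quat 1 0 0 0 = 1" by (simp add: one_quat_def)
        then show ?thesis using qw2[of i i ?\<beta> s s] that True
          by (auto simp: act_def base_quat_def divisible_quat_def)
      next
        case False
        show ?thesis
        proof
          assume "divisible_quat (act (four ?\<beta>) ?q (base_quat (four ?\<beta>)))"
          then have "divisible_at (end_form \<iota> (Quat 0 1 0 0) (slot s i))"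
            using False ends[OF that, of ?\<beta> s]
            by (intro contract_three_end_form[OF \<iota> p(1), of "slot s i" "slot (\<not> s) i" "qconj ?q"])
              (auto simp: base_quat_def integral_quat_def intro: has_ends_conj)
          then have "divisible_at (2 * (\<iota> * slot s i))" by (simp add: end_form_def mult.assoc)
          moreover have "\<not> divisible_at (2 * (\<iota> * slot s i))"
            by (intro not_divisible_mult integral_intros two_not_divisible p \<iota>_not_divisible[OF \<iota>] slot_not_divisible[OF p(2) that] \<iota>) auto
          ultimately show False by blast
        qed
      qed
      then have nd: "\<not> divisible_vec (real p ^ Suc i *\<^sub>R block_act (letter b s i) base_point)"
        using letter_divisible_iff[OF exact[OF that] base_integral, of s] block_base_point[of ?\<beta>]
        by (metis rangeI)
      have "integral_vec (real p ^ Suc i *\<^sub>R block_act (letter b s i) base_point)"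
        by (rule letter_integral[OF exact[OF that] base_integral])
      with nd have "has_val 0 (real p powi int (Suc i) *\<^sub>R block_act (letter b s i) base_point)"
        by (simp add: has_val_def val_ge_0 val_ge_1 del: power_Suc of_nat_Suc)
      then have "has_val (- \<kappa> - int (Suc i)) (block_act (letter b s i) u)"
        by (simp add: u linear_cmul[OF linear_block_act] has_val_scale)
      with u_val show ?thesis unfolding expands_def by blast
    qed
  qed (use u_small room in auto)
qed

end

section \<open>Choice of the letters and the conclusion\<close>

text \<open>Any prime divisor of \<open>((N + 2)!)\<^sup>2 + 1\<close> will do.\<close>

lemma prime_with_root_of_minus_one:
  obtains p :: nat and \<iota> :: int where "prime p" "p > N" "odd p" "int p dvd \<iota>\<^sup>2 + 1"
proof -
  define M where "M = (fact (N + 2) :: nat)"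
  have "M\<^sup>2 + 1 \<noteq> 1" by (simp add: M_def)
  then obtain p where p: "prime p" "p dvd M\<^sup>2 + 1" using prime_factor_nat by blast
  have "\<not> p \<le> N + 2"
  proof
    assume "p \<le> N + 2"
    then have "p dvd M" unfolding M_def using prime_ge_1_nat[OF p(1)] by (intro dvd_fact)
    then have "p dvd M\<^sup>2" by (simp add: power2_eq_square)
    with p(2) have "p dvd 1" by (metis dvd_add_right_iff)
    with p(1) show False by simp
  qed
  then have "p > N" "p \<noteq> 2" by auto
  moreover have "odd p" using p(1) \<open>p \<noteq> 2\<close> prime_odd_nat[of p] prime_ge_2_nat[of p] by force
  moreover have "int p dvd (int M)\<^sup>2 + 1"
    using p(2) by (metis int_dvd_int_iff of_nat_1 of_nat_add of_nat_power)
  ultimately show ?thesis using that p(1) by blast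
qed

context prime_place begin

text \<open>Only the real component of the residue quaternion has to be adjusted to give the norm the prescribed
power of \<open>p\<close>; it is \<open>\<iota>\<close>, a unit, because consecutive parameters are used.\<close>

lemma exact_residue:
  fixes \<iota> l m :: int
  assumes p: "odd p" and \<iota>: "int p dvd \<iota>\<^sup>2 + 1" and lm: "m = l + 1"
  obtains a where "integral_quat a" "has_ends (of_int \<iota>) (of_int l) (of_int m) a"
    "integral_at (qnorm a / real p ^ Suc e)" "\<not> divisible_at (qnorm a / real p ^ Suc e)"
proof -
  define R where "R = (l + m)\<^sup>2 + (\<iota> * (1 + l * m))\<^sup>2 + (l * m - 1)\<^sup>2"
  have "\<iota>\<^sup>2 + R = (\<iota>\<^sup>2 + 1) * (1 + (1 + l * m)\<^sup>2)"
    by (simp add: R_def lm power2_eq_square algebra_simps)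
  then have R: "int p dvd \<iota>\<^sup>2 + R" using \<iota> by simp
  have "\<not> int p dvd \<iota>"
  proof
    assume "int p dvd \<iota>"
    then have "int p dvd \<iota>\<^sup>2" by (simp add: power2_eq_square)
    with \<iota> have "int p dvd 1" using dvd_add_right_iff by blast
    then show False using prime_int not_prime_unit by blast
  qed
  from hensel_square_exact[OF prime_int _ this R, of e] p obtain v where
    v: "int p dvd v - \<iota>" "int p ^ Suc e dvd v\<^sup>2 + R" "\<not> int p ^ Suc (Suc e) dvd v\<^sup>2 + R" by auto
  then obtain k where k: "v\<^sup>2 + R = int p ^ Suc e * k" unfolding dvd_def by blast
  define a where "a = Quat (of_int v) (of_int (l + m)) (of_int (- \<iota> * (1 + l * m))) (of_int (l * m - 1))"
  have "integral_quat a" unfolding integral_quat_def a_def quat.sel by (intro conjI integral_of_int)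
  moreover have "has_ends (of_int \<iota>) (of_int l) (of_int m) a"
  proof -
    have "a - 1 *\<^sub>R residue (of_int \<iota>) (of_int l) (of_int m) = Quat (of_int (v - \<iota>)) 0 0 0"
      by (simp add: a_def residue_def lm quat_ops)
    then show ?thesis using v(1) divisible_of_int[of "v - \<iota>"]
      unfolding has_ends_def by (intro bexI[of _ 1]) (auto simp: divisible_quat_def)
  qed
  moreover have q: "qnorm a / real p ^ Suc e = of_int k"
  proof -
    have "qnorm a = of_int (v\<^sup>2 + R)" by (simp add: qnorm_def a_def R_def power_mult_distrib)
    also have "\<dots> = real p ^ Suc e * of_int k" by (simp add: k)
    finally show ?thesis using p_pos by simp
  qed
  moreover have "\<not> int p dvd k"
  proof
    assume "int p dvd k"
    then have "int p ^ Suc e * int p dvd v\<^sup>2 + R" unfolding k by (intro mult_dvd_mono) auto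
    with v(3) show False by (simp add: mult.commute)
  qed
  ultimately show ?thesis using that[of a] by (simp add: q divisible_of_int)
qed

text \<open>Adding multiples of a higher power of \<open>p\<close> changes neither the residue nor the power of \<open>p\<close> in the
norm. This is the freedom that moves the letter to a prescribed real position.\<close>

lemma exact_residue_translate:
  assumes a: "integral_quat a" "has_ends \<iota> l m a" "integral_at (qnorm a / real p ^ Suc e)" "\<not> divisible_at (qnorm a / real p ^ Suc e)"
    and T: "integral_quat T" and s: "s = real p ^ Suc (Suc e) * r" "integral_at r"
  shows "integral_quat (a + s *\<^sub>R T)" "has_ends \<iota> l m (a + s *\<^sub>R T)"
    "integral_at (qnorm (a + s *\<^sub>R T) / real p ^ Suc e)" "\<not> divisible_at (qnorm (a + s *\<^sub>R T) / real p ^ Suc e)"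
proof -
  have s': "s = of_int (int p) * (real p ^ Suc e * r)" by (simp add: s(1) ac_simps)
  have "integral_at (real p ^ Suc e * r)" using s(2) by (intro integral_intros) auto
  then have ds: "divisible_at s" unfolding s' using divisible_of_int[of "int p"] by (intro divisible_mult(1)) auto
  then have dsT: "divisible_quat (s *\<^sub>R T)" using T by (intro divisible_quat_ideal(7))
  show "integral_quat (a + s *\<^sub>R T)"
    using a(1) T divisible_imp_integral[OF ds] by (intro integral_quat_simps)
  from a(2) obtain \<sigma> where \<sigma>: "\<sigma> \<in> {1, - 1}" "divisible_quat (a - \<sigma> *\<^sub>R residue \<iota> l m)"
    unfolding has_ends_def by blast
  have "divisible_quat ((a - \<sigma> *\<^sub>R residue \<iota> l m) + s *\<^sub>R T)" using \<sigma>(2) dsT by (rule divisible_quat_ideal(1))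
  then show "has_ends \<iota> l m (a + s *\<^sub>R T)" unfolding has_ends_def using \<sigma>(1)
    by (intro bexI[of _ \<sigma>]) (auto simp: algebra_simps)
  define h where "h = r * (2 * qw (a * qconj T) + s * qnorm T)"
  have h: "integral_at h" unfolding h_def
    using a(1) T s(2) divisible_imp_integral[OF ds]
    by (intro integral_intros integral_comps integral_quat_simps integral_qnorm) auto
  have "qnorm (a + s *\<^sub>R T) = qnorm a + s * (2 * qw (a * qconj T) + s * qnorm T)"
    by (simp add: qnorm_def qconj_def quat_ops power2_eq_square algebra_simps)
  also have "\<dots> / real p ^ Suc e = qnorm a / real p ^ Suc e + of_int (int p) * h"
    using p_pos by (simp add: h_def s(1) add_divide_distrib)
  finally have eq: "qnorm (a + s *\<^sub>R T) / real p ^ Suc e = qnorm a / real p ^ Suc e + of_int (int p) * h" .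
  have dh: "divisible_at (of_int (int p) * h)" using h divisible_of_int[of "int p"] by (intro divisible_mult(1)) auto
  show "integral_at (qnorm (a + s *\<^sub>R T) / real p ^ Suc e)"
    unfolding eq using a(3) divisible_imp_integral[OF dh] by (rule integral_add)
  show "\<not> divisible_at (qnorm (a + s *\<^sub>R T) / real p ^ Suc e)"
    unfolding eq using a(4) divisible_diff[OF _ dh] by fastforce
qed

lemma targets_integral: "T \<in> targets \<Longrightarrow> integral_quat T"
  using integral_of_int[of "- 1"] by (auto simp: targets_def integral_quat_def)

end

lemma targets_nonzero: "T \<in> targets \<Longrightarrow> qnorm T \<noteq> 0"
  by (auto simp: targets_def qnorm_def)

context quaternionic_blocks begin

text \<open>The targets are listed so that each choice of one target per block occurs for four letters, which
gives every point the four labels that it needs. The letters approximate their targets up to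
\<open>\<delta>\<close>, half of the margin in \<open>target_direction\<close>. The translation vector is the base point divided by
a large power of \<open>p\<close>: division makes it short without affecting which letters expand it.\<close>

theorem ball_divisible:
  fixes B :: "(real ^ 'n) set"
  assumes B: "B = ball 0 1 \<or> B = cball 0 1"
  shows "\<exists>m\<ge>2. m_divisible m B"
proof -
  define F where "F = PiE (range blk) (\<lambda>_. targets)"
  have "finite targets" by (simp add: targets_def)
  then have F: "finite F" unfolding F_def by (intro finite_PiE) auto
  define N where "N = card F"
  obtain h where h: "bij_betw h {0..<N} F" using ex_bij_betw_nat_finite[OF F] N_def by auto
  define n where "n = 4 * N"
  define T where "T i = h (i div 4)" for i
  have T: "T i \<beta> \<in> targets" if "i < n" "\<beta> \<in> range blk" for i \<beta>
  proof -
    have "T i \<in> F" using h that(1) unfolding T_def n_def bij_betw_def by auto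
    then show ?thesis using that(2) by (auto simp: F_def)
  qed
  have T_cover: "\<exists>I \<subseteq> {..<n}. card I = 4 \<and> (\<forall>i\<in>I. \<forall>\<beta>\<in>range blk. T i \<beta> = S \<beta>)"
    if S: "S ` range blk \<subseteq> targets" for S
  proof -
    have "restrict S (range blk) \<in> F" using S by (auto simp: F_def)
    then obtain q where q: "q < N" "h q = restrict S (range blk)" 
      using h unfolding bij_betw_def by (metis atLeastLessThan_iff imageE)
    have "i div 4 = q" if "4 * q \<le> i" "i < 4 * q + 4" for i using that by presburger
    then show ?thesis
      by (intro exI[of _ "{4 * q..<4 * q + 4}"]) (use q in \<open>auto simp: n_def T_def\<close>)
  qed
  have "block_act S x = block_act S' x" if "\<And>\<beta>. \<beta> \<in> range blk \<Longrightarrow> S \<beta> = S' \<beta>" for S S' x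
    using that by (simp add: block_act_def)
  note block_act_cong = this
  define \<delta> where "\<delta> = 1 / (2 * real CARD('n))"
  have \<delta>: "\<delta> > 0" by (simp add: \<delta>_def)

  obtain p :: nat and \<iota> :: int where p: "prime p" "p > 2 * n + 2" "odd p" "int p dvd \<iota>\<^sup>2 + 1"
    using prime_with_root_of_minus_one by blast
  interpret adic_blocks blk pos p by unfold_locales (rule p(1))
  have "\<exists>a. integral_quat a \<and> has_ends (of_int \<iota>) (slot False i) (slot True i) a \<and>
      integral_at (qnorm a / real p ^ Suc i) \<and> \<not> divisible_at (qnorm a / real p ^ Suc i)" for i
    unfolding slot_def by (rule exact_residue[OF p(3,4), of "2 * int i + 2" "2 * int i + 1" i]) auto
  then obtain a where a: "\<And>i. integral_quat (a i)" "\<And>i. has_ends (of_int \<iota>) (slot False i) (slot True i) (a i)"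
    "\<And>i. integral_at (qnorm (a i) / real p ^ Suc i)" "\<And>i. \<not> divisible_at (qnorm (a i) / real p ^ Suc i)"
    by metis
  define b where "b j i \<beta> = a i + (real p ^ Suc (Suc i) * real j) *\<^sub>R T i \<beta>" for j i \<beta>
  have "\<forall>\<^sub>F j in sequentially. dist (block_act (b j i) base_point) (block_act (T i) base_point) < \<delta>" if "i < n" for i
  proof (rule tendstoD[OF _ \<delta>])
    have "filterlim (\<lambda>j. real p ^ Suc (Suc i) * real j) at_top sequentially"
      using p_pos by (intro filterlim_tendsto_pos_mult_at_top[OF tendsto_const] filterlim_real_sequentially) auto
    then show "(\<lambda>j. block_act (b j i) base_point) \<longlonglongrightarrow> block_act (T i) base_point"
      unfolding b_def using T[OF that] targets_nonzero by (intro block_act_tendsto) auto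
  qed
  then have "\<forall>\<^sub>F j in sequentially. \<forall>i\<in>{..<n}. dist (block_act (b j i) base_point) (block_act (T i) base_point) < \<delta>"
    by (intro eventually_ball_finite) auto
  then obtain j where j: "\<And>i. i < n \<Longrightarrow> dist (block_act (b j i) base_point) (block_act (T i) base_point) < \<delta>"
    unfolding eventually_sequentially by auto
  have b_ends: "has_ends (of_int \<iota>) (slot False i) (slot True i) (b j i \<beta>)"
    and b_exact: "integral_quat (b j i \<beta>)" "integral_at (qnorm (b j i \<beta>) / real p ^ Suc i)"
      "\<not> divisible_at (qnorm (b j i \<beta>) / real p ^ Suc i)"
    if "i < n" "\<beta> \<in> range blk" for i \<beta>
    using exact_residue_translate[OF a[of i] targets_integral[OF T[OF that]] refl, of "real j"]
    unfolding b_def by auto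
  have exact: "exact_letter (Suc i) (b j i)" if "i < n" for i
    using b_exact[OF that] unfolding exact_letter_def by blast

  \<comment> \<open>The bound ensures both that \<open>u\<close> is shorter than \<open>1 / 2\<close> and
    that its squared length is at most \<open>s * \<delta>\<close>.\<close>
  obtain \<kappa> :: nat where \<kappa>: "real p ^ \<kappa> > 1 + 2 * norm (base_point :: real ^ 'n) + (norm (base_point :: real ^ 'n))\<^sup>2 / \<delta>"
    using real_arch_pow[of "real p"] prime_gt_1_nat[OF p(1)] by auto
  define s where "s = real p powi (- int \<kappa>)"
  define u where "u = s *\<^sub>R (base_point :: real ^ 'n)"
  have s: "s > 0" "s * (1 + 2 * norm (base_point :: real ^ 'n) + (norm (base_point :: real ^ 'n))\<^sup>2 / \<delta>) < 1"
    using \<kappa> p_pos by (auto simp: s_def power_int_minus field_simps)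
  have "s * (2 * norm (base_point :: real ^ 'n)) < 1"
  proof -
    have "s * (2 * norm (base_point :: real ^ 'n)) \<le> s * (1 + 2 * norm (base_point :: real ^ 'n) + (norm (base_point :: real ^ 'n))\<^sup>2 / \<delta>)"
      using s(1) \<delta> by (intro mult_left_mono) auto
    with s(2) show ?thesis by linarith
  qed
  then have u_small: "norm u < 1 / 2" using s(1) by (simp add: u_def)
  have "s * ((norm (base_point :: real ^ 'n))\<^sup>2 / \<delta>) < 1"
  proof -
    have "s * ((norm (base_point :: real ^ 'n))\<^sup>2 / \<delta>) \<le> s * (1 + 2 * norm (base_point :: real ^ 'n) + (norm (base_point :: real ^ 'n))\<^sup>2 / \<delta>)"
      using s(1) by (intro mult_left_mono) auto
    with s(2) show ?thesis by linarith
  qed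
  then have "s * (norm (base_point :: real ^ 'n))\<^sup>2 < \<delta>" using \<delta> by (simp add: field_simps)
  then have "s * (s * (norm (base_point :: real ^ 'n))\<^sup>2) \<le> s * \<delta>"
    using s(1) by (intro mult_left_mono) auto
  then have u_sq: "(norm u)\<^sup>2 \<le> s * \<delta>"
    using s(1) by (simp add: u_def power_mult_distrib power2_eq_square ac_simps)

  have room: "4 \<le> card {i. i < n \<and> norm (block_act (letter (b j) False i) x + u) \<le> norm x}"
    if x: "1 / 2 \<le> norm x" "norm x \<le> 1" for x
  proof -
    obtain S where S: "S ` range blk \<subseteq> targets" "x \<bullet> block_act S base_point \<le> - (norm x / real CARD('n))"
      using target_direction[of x] by blast
    obtain I where I: "I \<subseteq> {..<n}" "card I = 4" "\<And>i \<beta>. i \<in> I \<Longrightarrow> \<beta> \<in> range blk \<Longrightarrow> T i \<beta> = S \<beta>"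
      using T_cover[OF S(1)] by blast
    have "norm (block_act (letter (b j) False i) x + u) \<le> norm x" if "i \<in> I" for i
    proof -
      have i: "i < n" using I(1) that by auto
      have nz: "qnorm (b j i \<beta>) \<noteq> 0" if "\<beta> \<in> range blk" for \<beta>
        using exact_letter_unit(1)[OF exact[OF i] that] .
      let ?g = "block_act (letter (b j) False i)" and ?f = "block_act (b j i)"
      have g: "?g = block_act (\<lambda>\<beta>. qconj (b j i \<beta>))" by (simp add: letter_def[abs_def])
      have norm_f: "norm (?f y) = norm y" for y using norm_block_act nz by blast
      have norm_g: "norm (?g y) = norm y" for y unfolding g using norm_block_act nz by simp
      have fg: "?f (?g y) = y" for y
        using block_act_inverse[of "\<lambda>\<beta>. qconj (b j i \<beta>)" y] nz by (simp add: g)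
      have "orthogonal_transformation ?f"
        unfolding orthogonal_transformation using norm_f linear_block_act by blast
      then have "?g x \<bullet> u = ?f (?g x) \<bullet> ?f u" by (simp add: orthogonal_transformation_def)
      also have "\<dots> = s * (x \<bullet> ?f base_point)"
        by (simp add: fg u_def linear_cmul[OF linear_block_act])
      finally have inner: "?g x \<bullet> u = s * (x \<bullet> ?f base_point)" .
      have "block_act (T i) base_point = block_act S base_point" using I(3)[OF that] by (rule block_act_cong)
      then have "x \<bullet> ?f base_point = x \<bullet> block_act S base_point + x \<bullet> (?f base_point - block_act (T i) base_point)"
        by (simp add: inner_diff_right)
      also have "x \<bullet> (?f base_point - block_act (T i) base_point) \<le> norm x * \<delta>"
      proof -
        have "x \<bullet> (?f base_point - block_act (T i) base_point) \<le> norm x * norm (?f base_point - block_act (T i) base_point)"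
          by (rule norm_cauchy_schwarz)
        also have "\<dots> \<le> norm x * \<delta>"
          using j[OF i] by (intro mult_left_mono) (auto simp: dist_norm)
        finally show ?thesis .
      qed
      finally have "x \<bullet> ?f base_point \<le> - (norm x / real CARD('n)) + norm x * \<delta>" using S(2) by linarith
      also have "\<dots> = - (norm x * \<delta>)" by (simp add: \<delta>_def field_simps)
      also have "\<dots> \<le> - (\<delta> / 2)" using x(1) \<delta> by simp
      finally have "s * (x \<bullet> ?f base_point) \<le> s * (- (\<delta> / 2))" using s(1) by (intro mult_left_mono) auto
      then have "2 * (?g x \<bullet> u) + (norm u)\<^sup>2 \<le> 0" using u_sq unfolding inner by simp
      moreover have "(norm (?g x + u))\<^sup>2 = (norm x)\<^sup>2 + (2 * (?g x \<bullet> u) + (norm u)\<^sup>2)"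
        using norm_g[of x] by (simp add: power2_norm_eq_inner inner_add_left inner_add_right inner_commute)
          (metis power2_norm_eq_inner)
      ultimately have "(norm (?g x + u))\<^sup>2 \<le> (norm x)\<^sup>2" by linarith
      then show ?thesis by (rule power2_le_imp_le) simp
    qed
    then have "I \<subseteq> {i. i < n \<and> norm (block_act (letter (b j) False i) x + u) \<le> norm x}" using I(1) by blast
    from card_mono[OF _ this] I(2) show ?thesis by simp
  qed
  have "expanding_isometries p n Suc (\<lambda>s i. block_act (letter (b j) s i)) u"
  proof (rule expanding_isometries_blocks[of "of_int \<iota>"])
    show "divisible_at ((real_of_int \<iota>)\<^sup>2 + 1)" using p(4) divisible_of_int[of "\<iota>\<^sup>2 + 1"] by simp
    show "u = real p powi (- int \<kappa>) *\<^sub>R base_point" by (simp add: u_def s_def)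
  qed (use p b_ends exact u_small room in auto)
  then have "m_divisible (Suc n) B" using B by (rule expanding_isometries.divisible)
  moreover have "Suc n \<ge> 2"
  proof -
    obtain S where "S ` range blk \<subseteq> targets" using target_direction[of "0 :: real ^ 'n"] by blast
    from T_cover[OF this] obtain I where "I \<subseteq> {..<n}" "card I = 4" by blast
    from card_mono[OF _ this(1)] this(2) show ?thesis by simp
  qed
  ultimately show ?thesis by blast
qed

end

lemma quaternionic_blocks_exist:
  assumes "CARD('n::finite) = 3 * a + 4 * b"
  obtains blk pos :: "'n::finite \<Rightarrow> nat" where "quaternionic_blocks blk pos"
proof -
  obtain h :: "'n \<Rightarrow> nat" where h: "bij_betw h UNIV {0..<CARD('n)}"
    using ex_bij_betw_finite_nat[of "UNIV :: 'n set"] by auto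
  define blk where "blk k = (if h k < 3 * a then h k div 3 else a + (h k - 3 * a) div 4)" for k
  define pos where "pos k = (if h k < 3 * a then h k mod 3 + 1 else (h k - 3 * a) mod 4)" for k
  have inv: "\<exists>k. h k = j" if "j < 3 * a + 4 * b" for j
    using h that assms unfolding bij_betw_def by (metis UNIV_I atLeastLessThan_iff image_iff zero_le)
  have hlt: "h k < 3 * a + 4 * b" for k
    using h assms unfolding bij_betw_def by (metis atLeastLessThan_iff rangeI)
  have "quaternionic_blocks blk pos"
  proof
    fix k k' :: 'n assume eq: "blk k = blk k'" "pos k = pos k'"
    have three: "i = j" if "i div 3 = j div 3" "i mod 3 = j mod 3" for i j :: nat
      using that by (metis div_mult_mod_eq)
    have four: "i = j" if "i div 4 = j div 4" "i mod 4 = j mod 4" for i j :: nat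
      using that by (metis div_mult_mod_eq)
    have small: "blk j < a \<longleftrightarrow> h j < 3 * a" for j
      by (auto simp: blk_def)
    have "h k = h k'"
    proof (cases "h k < 3 * a")
      case True
      with small eq have "h k' < 3 * a" by metis
      with True eq have "h k div 3 = h k' div 3" "h k mod 3 = h k' mod 3"
        by (simp_all add: blk_def pos_def)
      then show ?thesis by (rule three)
    next
      case False
      with small eq have F: "\<not> h k' < 3 * a" by metis
      with False eq have "(h k - 3 * a) div 4 = (h k' - 3 * a) div 4" "(h k - 3 * a) mod 4 = (h k' - 3 * a) mod 4"
        by (simp_all add: blk_def pos_def)
      then have "h k - 3 * a = h k' - 3 * a" by (rule four)
      with False F show ?thesis by linarith
    qed
    then show "k = k'" using h by (simp add: bij_betw_def inj_eq)
  next
    fix k :: 'n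
    have "h k mod 3 < 3" "(h k - 3 * a) mod 4 < 4" by simp_all
    then show "pos k \<le> 3" unfolding pos_def by auto
  next
    fix c :: nat and k :: 'n assume c: "c \<in> {1, 2, 3}"
    show "\<exists>k'. blk k' = blk k \<and> pos k' = c"
    proof (cases "h k < 3 * a")
      case True
      define j where "j = 3 * (h k div 3) + (c - 1)"
      have c': "c - 1 < 3" "c - 1 + 1 = c" using c by auto
      have j: "j div 3 = h k div 3" "j mod 3 = c - 1"
        using div_mult_self3[of 3 "h k div 3" "c - 1"] c'(1) unfolding j_def by simp_all
      have "h k div 3 < a" using True by linarith
      then have "j < 3 * a" using c'(1) unfolding j_def by linarith
      moreover obtain k' where "h k' = j" using inv[of j] \<open>j < 3 * a\<close> by auto
      ultimately show ?thesis using True j c by (intro exI[of _ k']) (auto simp: blk_def pos_def)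
    next
      case False
      define j where "j = 4 * ((h k - 3 * a) div 4) + c"
      have c': "c < 4" using c by auto
      have j: "j div 4 = (h k - 3 * a) div 4" "j mod 4 = c"
        using c' unfolding j_def by simp_all
      have "h k - 3 * a < 4 * b" using hlt[of k] False by linarith
      then have "(h k - 3 * a) div 4 < b" by linarith
      then have "j < 4 * b" using c' unfolding j_def by linarith
      then obtain k' where "h k' = 3 * a + j" using inv[of "3 * a + j"] by auto
      then show ?thesis using False j c by (intro exI[of _ k']) (auto simp: blk_def pos_def)
    qed
  qed
  then show ?thesis using that by blast
qed

theorem theorem1p3:
  assumes "CARD('n::finite) \<ge> 6 \<or> CARD('n) \<in> {3, 4}"
  shows "(\<exists>m\<ge>2. m_divisible m (ball 0 1 :: (real ^ 'n) set)) \<and>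
         (\<exists>m\<ge>2. m_divisible m (cball 0 1 :: (real ^ 'n) set))"
proof -
  have "\<exists>a b. d = 3 * a + 4 * b" if "d \<ge> 6 \<or> d = 3 \<or> d = 4" for d :: nat
    using that by presburger
  with assms have "\<exists>a b. CARD('n) = 3 * a + 4 * b" by simp
  then obtain a b where "CARD('n) = 3 * a + 4 * b" by blast
  then obtain blk pos :: "'n \<Rightarrow> nat" where "quaternionic_blocks blk pos"
    by (rule quaternionic_blocks_exist)
  then interpret quaternionic_blocks blk pos .
  show ?thesis using ball_divisible by blast
qed

end
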